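(* Let $B$ be a finitely generated subgroup of a diagram group $G$ and let $A$ be a finitely generated abelian subgroup of $B$. Then $A$ embeds into $B$ quasi-isometrically.
   Context: Quasi-isometric embedding. For a group with finite generating set $X$, $|g|_X$ denotes the word length of $g$ with respect to $X$. If $A\le B$ are finitely generated groups with finite generating sets $X$ of $A$ and $Y$ of $B$, then $A$ embeds into $B$ quasi-isometrically (without distortion) if there is a positive integer constant $C$ with $|g|_X\le C|g|_Y$ for all $g\in A$; this does not depend on the choice of $X$ and $Y$. Diagram groups. A semigroup presentation $\mathcal{P}=\langle\Sigma\mid\mathcal{R}\rangle$ consists of an alphabet $\Sigma$ and a set $\mathcal{R}$ of pairs $(u,v)$ of non-empty words over $\Sigma$, written $u=v$; presentations are assumed anti-symmetric: if $(u=v)\in\mathcal{R}$ then $(v=u)\notin\mathcal{R}$. $\Sigma^+$ and $\Sigma^*$ are the free semigroup and free monoid on $\Sigma$. The graph $\Gamma(\mathcal{P})$ has vertex set $\Sigma^+$ and an edge $(p,u\to v,q)$ from $puq$ to $pvq$ for all $p,q\in\Sigma^*$ and all $u,v$ with $(u=v)\in\mathcal{R}$ or $(v=u)\in\mathcal{R}$; the inverse edge is $(p,v\to u,q)$. The Squier complex $\mathcal{K}(\mathcal{P})$ is the 2-complex obtained from $\Gamma(\mathcal{P})$ by attaching, for all $p,z,q\in\Sigma^*$ and $(\ell_1=r_1),(\ell_2=r_2)\in\mathcal{R}$, a 2-cell along the closed path $p_1p_2^{-1}$, where $p_1=(p,\ell_1\to r_1,z\ell_2q)(pr_1z,\ell_2\to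 r_2,q)$ and $p_2=(p\ell_1z,\ell_2\to r_2,q)(p,\ell_1\to r_1,zr_2q)$. For $w\in\Sigma^+$ the diagram group $\mathcal{D}(\mathcal{P},w)$ is (up to isomorphism, by Kilibarda's theorem; this may be taken as the definition) the fundamental group $\pi_1(\mathcal{K}(\mathcal{P}),w)$. A group is a diagram group if it is isomorphic to some $\mathcal{D}(\mathcal{P},w)$. *)

theory Defs
  imports "HOL-Algebra.Generated_Groups"
begin

section \<open>Word length and undistorted subgroups\<close>

definition word_length :: "('g, 'm) monoid_scheme \<Rightarrow> 'g set \<Rightarrow> 'g \<Rightarrow> nat" where
  "word_length G X g =
     (LEAST n. \<exists>xs. length xs = n \<and> set xs \<subseteq> X \<union> m_inv G ` X \<and>
        foldr (mult G) xs (one G) = g)"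

definition finite_generating_set :: "('g, 'm) monoid_scheme \<Rightarrow> 'g set \<Rightarrow> 'g set \<Rightarrow> bool" where
  "finite_generating_set G H X \<longleftrightarrow> finite X \<and> X \<subseteq> carrier G \<and> generate G X = H"

text \<open>
  \<open>A\<close> and \<open>B\<close> are subgroups of an ambient group \<open>G\<close>; since they inherit products and inverses
  from \<open>G\<close>, word lengths are evaluated in \<open>G\<close>. The notion does not depend on the generating sets,
  and all pairs of finite generating sets are required to work. To be used only for
  finitely generated \<open>A\<close> and \<open>B\<close> (otherwise the condition is vacuous).
\<close>
definition quasi_isometrically_embedded ::
    "('g, 'm) monoid_scheme \<Rightarrow> 'g set \<Rightarrow> 'g set \<Rightarrow> bool" where
  "quasi_isometrically_embedded G A B \<longleftrightarrow>
     (\<forall>X Y. finite_generating_set G A X \<longrightarrow> finite_generating_set G B Y \<longrightarrow>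
        (\<exists>C::nat. C > 0 \<and> (\<forall>g\<in>A. word_length G X g \<le> C * word_length G Y g)))"


section \<open>Semigroup presentations and the Squier complex\<close>

definition nonempty_words :: "'a set \<Rightarrow> 'a list set" where
  "nonempty_words S = lists S - {[]}"

text \<open>
  The last condition is imposed for \<open>u = v\<close> as well, so that \<open>(u, u)\<close> is never a relation and
  no edge of the Squier complex is its own inverse.
\<close>
definition semigroup_presentation :: "'a set \<Rightarrow> ('a list \<times> 'a list) set \<Rightarrow> bool" where
  "semigroup_presentation S R \<longleftrightarrow>
     R \<subseteq> nonempty_words S \<times> nonempty_words S \<and>
     (\<forall>u v. (u, v) \<in> R \<longrightarrow> (v, u) \<notin> R)"

text \<open>\<open>Edge p u v q\<close> is the edge \<open>(p, u \<rightarrow> v, q)\<close>.\<close>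
datatype 'a edge = Edge "'a list" "'a list" "'a list" "'a list"

fun origin :: "'a edge \<Rightarrow> 'a list" where
  "origin (Edge p u v q) = p @ u @ q"

fun terminus :: "'a edge \<Rightarrow> 'a list" where
  "terminus (Edge p u v q) = p @ v @ q"

fun inverse_edge :: "'a edge \<Rightarrow> 'a edge" where
  "inverse_edge (Edge p u v q) = Edge p v u q"

definition edges :: "'a set \<Rightarrow> ('a list \<times> 'a list) set \<Rightarrow> 'a edge set" where
  "edges S R = {Edge p u v q | p u v q.
     p \<in> lists S \<and> q \<in> lists S \<and> ((u, v) \<in> R \<or> (v, u) \<in> R)}"

fun is_path :: "'a set \<Rightarrow> ('a list \<times> 'a list) set \<Rightarrow> 'a list \<Rightarrow> 'a edge list \<Rightarrow> 'a list \<Rightarrow> bool" where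
  "is_path S R x [] y \<longleftrightarrow> x \<in> nonempty_words S \<and> x = y"
| "is_path S R x (e # es) y \<longleftrightarrow> e \<in> edges S R \<and> origin e = x \<and> is_path S R (terminus e) es y"

text \<open>A 2-cell attached along \<open>p\<^sub>1 p\<^sub>2\<^sup>-\<^sup>1\<close> is recorded as the pair \<open>(p\<^sub>1, p\<^sub>2)\<close>.\<close>
definition squier_cells ::
    "'a set \<Rightarrow> ('a list \<times> 'a list) set \<Rightarrow> ('a edge list \<times> 'a edge list) set" where
  "squier_cells S R =
     {([Edge p l1 r1 (z @ l2 @ q), Edge (p @ r1 @ z) l2 r2 q],
       [Edge (p @ l1 @ z) l2 r2 q, Edge p l1 r1 (z @ r2 @ q)]) | p z q l1 r1 l2 r2.
      p \<in> lists S \<and> z \<in> lists S \<and> q \<in> lists S \<and> (l1, r1) \<in> R \<and> (l2, r2) \<in> R}"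


section \<open>Diagram groups\<close>

text \<open>
  Homotopy of edge paths from \<open>x\<close> to \<open>y\<close> in the Squier complex. Replacing other portions of the
  boundary of a 2-cell by their complements is obtained by combining \<open>cell\<close> with \<open>cancel\<close>.
\<close>
inductive homotopic ::
    "'a set \<Rightarrow> ('a list \<times> 'a list) set \<Rightarrow> 'a list \<Rightarrow> 'a list \<Rightarrow> 'a edge list \<Rightarrow> 'a edge list \<Rightarrow> bool"
  for S R x y where
  refl: "is_path S R x s y \<Longrightarrow> homotopic S R x y s s"
| sym: "homotopic S R x y s t \<Longrightarrow> homotopic S R x y t s"
| trans: "homotopic S R x y s t \<Longrightarrow> homotopic S R x y t r \<Longrightarrow> homotopic S R x y s r"
| cancel: "is_path S R x (s @ [e, inverse_edge e] @ t) y \<Longrightarrow>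
    homotopic S R x y (s @ [e, inverse_edge e] @ t) (s @ t)"
| cell: "(p1, p2) \<in> squier_cells S R \<Longrightarrow> is_path S R x (s @ p1 @ t) y \<Longrightarrow>
    homotopic S R x y (s @ p1 @ t) (s @ p2 @ t)"

definition loops :: "'a set \<Rightarrow> ('a list \<times> 'a list) set \<Rightarrow> 'a list \<Rightarrow> 'a edge list set" where
  "loops S R w = {s. is_path S R w s w}"

definition loop_homotopy ::
    "'a set \<Rightarrow> ('a list \<times> 'a list) set \<Rightarrow> 'a list \<Rightarrow> ('a edge list \<times> 'a edge list) set" where
  "loop_homotopy S R w = {(s, t). homotopic S R w w s t}"

text \<open>The fundamental group of the Squier complex, as the edge path group based at \<open>w\<close>.\<close>
definition diagram_group ::
    "'a set \<Rightarrow> ('a list \<times> 'a list) set \<Rightarrow> 'a list \<Rightarrow> 'a edge list set monoid" where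
  "diagram_group S R w =
     \<lparr>carrier = loops S R w // loop_homotopy S R w,
      mult = (\<lambda>P Q. \<Union>s\<in>P. \<Union>t\<in>Q. loop_homotopy S R w `` {s @ t}),
      one = loop_homotopy S R w `` {[]}\<rparr>"


subsection \<open>Diagram groups are groups\<close>


lemma origin_nonempty_word:
  assumes "semigroup_presentation S R" "e \<in> edges S R"
  shows "origin e \<in> nonempty_words S" "terminus e \<in> nonempty_words S"
proof -
  from assms(1) have "u \<in> lists S \<and> v \<in> lists S \<and> u \<noteq> [] \<and> v \<noteq> []" if "(u, v) \<in> R" for u v
    using that unfolding semigroup_presentation_def nonempty_words_def by blast
  then show "origin e \<in> nonempty_words S" "terminus e \<in> nonempty_words S"
    using assms(2) by (fastforce simp: edges_def nonempty_words_def)+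
qed

lemma inverse_edge_simps [simp]:
  "inverse_edge e \<in> edges S R \<longleftrightarrow> e \<in> edges S R"
  "origin (inverse_edge e) = terminus e" "terminus (inverse_edge e) = origin e"
  "inverse_edge (inverse_edge e) = e"
  by (cases e; auto simp: edges_def)+

context
  fixes S :: "'a set" and R
  assumes pres: "semigroup_presentation S R"
begin

lemma is_path_nonempty_words:
  "is_path S R x s y \<Longrightarrow> x \<in> nonempty_words S \<and> y \<in> nonempty_words S"
  by (induction s arbitrary: x) (auto simp: origin_nonempty_word[OF pres])

lemma is_path_append:
  "is_path S R x (s @ t) y \<longleftrightarrow> (\<exists>m. is_path S R x s m \<and> is_path S R m t y)"
  by (induction s arbitrary: x) (auto dest: is_path_nonempty_words)

lemma squier_cells_path:
  assumes "(p1, p2) \<in> squier_cells S R"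
  shows "is_path S R x p1 y \<longleftrightarrow> is_path S R x p2 y"
proof -
  obtain p z q l1 r1 l2 r2 where
    eq: "p1 = [Edge p l1 r1 (z @ l2 @ q), Edge (p @ r1 @ z) l2 r2 q]"
      "p2 = [Edge (p @ l1 @ z) l2 r2 q, Edge p l1 r1 (z @ r2 @ q)]"
    and R: "(l1, r1) \<in> R" "(l2, r2) \<in> R"
    and lists: "p \<in> lists S" "z \<in> lists S" "q \<in> lists S"
    using assms unfolding squier_cells_def by blast
  have "l1 \<in> lists S" "r1 \<in> lists S" "l2 \<in> lists S" "r2 \<in> lists S"
    using pres R unfolding semigroup_presentation_def nonempty_words_def by blast+
  with R lists show ?thesis
    unfolding eq by (simp add: edges_def)
qed

lemma homotopic_is_path:
  "homotopic S R x y s t \<Longrightarrow> is_path S R x s y \<and> is_path S R x t y"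
  by (induction rule: homotopic.induct) (auto simp: is_path_append squier_cells_path)

lemma homotopic_append:
  assumes "homotopic S R x y s t" "is_path S R a p x" "is_path S R y q b"
  shows "homotopic S R a b (p @ s @ q) (p @ t @ q)"
  using assms(1)
proof (induction rule: homotopic.induct)
  case (refl s)
  have "is_path S R a (p @ s @ q) b"
    using refl assms(2,3) unfolding is_path_append by blast
  then show ?case by (rule homotopic.refl)
next
  case (sym s t)
  from sym.IH show ?case by (rule homotopic.sym)
next
  case (trans s t r)
  from trans.IH show ?case by (rule homotopic.trans)
next
  case (cancel s e t)
  have "is_path S R a ((p @ s) @ [e, inverse_edge e] @ (t @ q)) b"
    using cancel assms(2,3) unfolding is_path_append by blast
  from homotopic.cancel[OF this] show ?case by simp
next
  case (cell p1 p2 s t)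
  have "is_path S R a ((p @ s) @ p1 @ (t @ q)) b"
    using cell assms(2,3) unfolding is_path_append by blast
  from homotopic.cell[OF cell(1) this] show ?case by simp
qed

lemma homotopic_append2:
  assumes "homotopic S R x y s s'" "homotopic S R y z t t'"
  shows "homotopic S R x z (s @ t) (s' @ t')"
proof -
  have n: "is_path S R x [] x" "is_path S R z [] z"
    using assms by (auto dest!: homotopic_is_path is_path_nonempty_words)
  have "homotopic S R x z ([] @ s @ t) ([] @ s' @ t)"
    by (rule homotopic_append[OF assms(1)]) (use n assms homotopic_is_path in auto)
  moreover have "homotopic S R x z (s' @ t @ []) (s' @ t' @ [])"
    by (rule homotopic_append[OF assms(2)]) (use n assms homotopic_is_path in auto)
  ultimately show ?thesis using homotopic.trans by auto
qed

lemma inverse_path: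
  assumes "is_path S R x s y"
  shows "is_path S R y (rev (map inverse_edge s)) x"
    and "homotopic S R y y (rev (map inverse_edge s) @ s) []"
proof -
  have "is_path S R y (rev (map inverse_edge s)) x \<and>
    homotopic S R y y (rev (map inverse_edge s) @ s) []"
    using assms
  proof (induction s arbitrary: x)
    case Nil
    then show ?case by (auto intro: homotopic.refl)
  next
    case (Cons e s)
    let ?s = "rev (map inverse_edge s)"
    have e: "e \<in> edges S R" "origin e = x" and s: "is_path S R (terminus e) s y"
      using Cons.prems by auto
    have IH: "is_path S R y ?s (terminus e)" "homotopic S R y y (?s @ s) []"
      using Cons.IH[OF s] by auto
    have p: "is_path S R y (?s @ [inverse_edge e, inverse_edge (inverse_edge e)] @ s) y"
      using IH e s by (auto simp: is_path_append origin_nonempty_word[OF pres])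
    from homotopic.cancel[OF p] have "homotopic S R y y (?s @ [inverse_edge e, e] @ s) (?s @ s)"
      by simp
    with IH(2) homotopic.trans
    have "homotopic S R y y (?s @ [inverse_edge e, e] @ s) []" by fast
    moreover have "is_path S R y (?s @ [inverse_edge e]) x"
      using IH e by (auto simp: is_path_append origin_nonempty_word[OF pres])
    ultimately show ?case by simp
  qed
  then show "is_path S R y (rev (map inverse_edge s)) x"
    and "homotopic S R y y (rev (map inverse_edge s) @ s) []" by auto
qed

lemma equiv_loop_homotopy: "equiv (loops S R w) (loop_homotopy S R w)"
  by (rule equivI)
    (auto simp: loop_homotopy_def loops_def refl_on_def sym_def trans_def
      intro: homotopic.intros dest: homotopic_is_path)

lemma diagram_group_mult:
  assumes "s \<in> loops S R w" "t \<in> loops S R w"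
  shows "loop_homotopy S R w `` {s} \<otimes>\<^bsub>diagram_group S R w\<^esub> loop_homotopy S R w `` {t} =
    loop_homotopy S R w `` {s @ t}"
proof -
  have "congruent2 (loop_homotopy S R w) (loop_homotopy S R w)
      (\<lambda>s t. loop_homotopy S R w `` {s @ t})"
    by (intro congruent2I' equiv_class_eq[OF equiv_loop_homotopy])
      (auto simp: loop_homotopy_def intro: homotopic_append2)
  then show ?thesis
    using UN_equiv_class2[OF equiv_loop_homotopy equiv_loop_homotopy _ assms]
    by (simp add: diagram_group_def)
qed

lemma group_diagram_group:
  assumes w: "w \<in> nonempty_words S"
  shows "group (diagram_group S R w)"
proof -
  let ?G = "diagram_group S R w" and ?c = "\<lambda>s. loop_homotopy S R w `` {s}"
  have carr: "carrier ?G = ?c ` loops S R w"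
    by (auto simp: diagram_group_def quotient_def)
  have app: "s @ t \<in> loops S R w" if "s \<in> loops S R w" "t \<in> loops S R w" for s t
    using that by (auto simp: loops_def is_path_append)
  have Nil: "[] \<in> loops S R w" and one: "\<one>\<^bsub>?G\<^esub> = ?c []"
    using w by (auto simp: loops_def diagram_group_def)
  have inv: "\<exists>t\<in>loops S R w. ?c (t @ s) = ?c []" if "s \<in> loops S R w" for s
  proof (rule bexI)
    show "rev (map inverse_edge s) \<in> loops S R w"
      using that inverse_path by (auto simp: loops_def)
    show "?c (rev (map inverse_edge s) @ s) = ?c []"
      by (rule equiv_class_eq[OF equiv_loop_homotopy])
        (use that inverse_path in \<open>auto simp: loops_def loop_homotopy_def\<close>)
  qed
  show ?thesis
  proof (rule groupI)
    fix x assume "x \<in> carrier ?G"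
    then obtain s where "s \<in> loops S R w" "x = ?c s" by (auto simp: carr)
    with inv[of s] show "\<exists>y\<in>carrier ?G. y \<otimes>\<^bsub>?G\<^esub> x = \<one>\<^bsub>?G\<^esub>"
      by (auto simp: carr one diagram_group_mult)
  qed (auto simp: carr one Nil app diagram_group_mult)
qed

end

end

theory Submission
  imports Defs "HOL-Algebra.FiniteProduct" "HOL-Analysis.Kronecker_Approximation_Theorem"
begin

text \<open>
An edge path in the Squier complex is a sequence of moves: at a position \<open>i\<close> of the current word
a relation is applied in one of its two directions. Forgetting the letters, an edge path becomes a
word of moves (position, relation, direction). Two consecutive moves at disjoint places can be
exchanged, which is what a 2-cell does, and a move can be cancelled against its reverse. Words of
moves modulo exchanges and cancellations form a group, in which homotopic loops become equal. The
theorem is reduced to this group and rests on three facts.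

Normal forms (\<open>normal_form_cong\<close>). As in partially commutative groups, every element is represented
by a word that cannot be shortened, and this word is unique up to exchanges, because any three
pairwise exchangeable moves span a cube. Hence shortest words are stable under moving everything to
the right, and a loop whose word is trivial contracts already in the Squier complex
(\<open>trivial_word_homotopic\<close>): exchanges and cancellations of moves lift to homotopies.

Uniform growth (\<open>length_power_word_ge\<close>). Every word for the \<open>n\<close>th power of a nontrivial element
has length at least \<open>n\<close>. This is shown by induction, replacing a word by a shorter conjugate or
by the same word one position further left. When neither is possible, the word may be rotated to
start with a move at position 0, and then all moves at position 0 survive in every power: two
consecutive ones could only cancel if what stands between them stays clear of both, and this would
give a shorter conjugate.

Diophantine approximation (\<open>word_length_le_len\<close>). Let \<open>len\<close> be a length function on an abelian
group generated by a finite set \<open>X\<close> such that \<open>len (g\<^sup>n) \<ge> n\<close> for all \<open>g \<noteq> 1\<close>. Take the exponent vector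
\<open>m\<close> of \<open>g\<close> with the least l1 norm \<open>n\<close>. There are a bounded \<open>q > 0\<close> and an integer vector \<open>p\<close> close to
\<open>(q / n) m\<close>. If the element \<open>h\<close> with exponents \<open>p\<close> is trivial, then \<open>m - p\<close> is a shorter exponent
vector for \<open>g\<close>. Otherwise \<open>n \<le> len (h\<^sup>n)\<close>, and \<open>h\<^sup>n\<close> differs from \<open>g\<^sup>q\<close> by a small error, so that
\<open>n\<close> is at most a constant times \<open>len g\<close>. So word length in \<open>A\<close> is bounded by a multiple of the
length of the shortest loop, which in turn is bounded by a multiple of word length in \<open>B\<close>.
\<close>

section \<open>Exchange systems and their normal forms\<close>

text \<open>
\<open>swap e f f' e'\<close> is a square with the two boundary paths \<open>e f\<close> and \<open>f' e'\<close>, where \<open>e'\<close> and \<open>f'\<close> are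
\<open>e\<close> and \<open>f\<close> after the exchange. \<open>swap_turn\<close> reads the same square from the end of \<open>e\<close>, and
\<open>swap_cube\<close> completes three squares around a corner to a cube: if in \<open>g e f\<close> each letter can be
exchanged with each other, the two ways of reversing the order agree.
\<close>
locale swap_system =
  fixes flip :: "'e \<Rightarrow> 'e"
    and swap :: "'e \<Rightarrow> 'e \<Rightarrow> 'e \<Rightarrow> 'e \<Rightarrow> bool"
  assumes flip_flip [simp]: "flip (flip e) = e"
    and swap_sym: "swap e f f' e' \<Longrightarrow> swap f' e' e f"
    and swap_unique: "swap e f f' e' \<Longrightarrow> swap e f f'' e'' \<Longrightarrow> f'' = f' \<and> e'' = e'"
    and swap_turn: "swap e f f' e' \<Longrightarrow> swap (flip e) f' f (flip e')"
    and not_swap_flip: "\<not> swap e (flip e) f' e'"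
    and swap_neq: "swap e f f' e' \<Longrightarrow> e \<noteq> f'" "swap e f f' e' \<Longrightarrow> f \<noteq> e'"
    and swap_cube: "swap g e e1 g1 \<Longrightarrow> swap e f f1 e2 \<Longrightarrow> swap g1 f f2 g2 \<Longrightarrow>
      \<exists>f3 g3 e3. swap g f1 f3 g3 \<and> swap g3 e2 e3 g2 \<and> swap e1 f2 f3 e3"
begin

definition swap_step :: "'e list \<Rightarrow> 'e list \<Rightarrow> bool" where
  "swap_step s t \<longleftrightarrow>
     (\<exists>a b e f f' e'. s = a @ [e, f] @ b \<and> t = a @ [f', e'] @ b \<and> swap e f f' e')"

abbreviation swap_eq :: "'e list \<Rightarrow> 'e list \<Rightarrow> bool" (infix "\<rightleftharpoons>" 50) where
  "s \<rightleftharpoons> t \<equiv> swap_step\<^sup>*\<^sup>* s t"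

lemma swap_step_sym: "swap_step s t \<Longrightarrow> swap_step t s"
  unfolding swap_step_def using swap_sym by blast

lemma swap_eq_sym: "s \<rightleftharpoons> t \<Longrightarrow> t \<rightleftharpoons> s"
  by (induction rule: rtranclp_induct)
    (auto intro: swap_step_sym converse_rtranclp_into_rtranclp)

lemma swap_eq_trans [trans]: "s \<rightleftharpoons> t \<Longrightarrow> t \<rightleftharpoons> u \<Longrightarrow> s \<rightleftharpoons> u"
  by (rule rtranclp_trans)

lemma swap_eq_left: "s \<rightleftharpoons> t \<Longrightarrow> s \<rightleftharpoons> u \<Longrightarrow> t \<rightleftharpoons> u"
  by (rule swap_eq_trans[OF swap_eq_sym])

lemma swap_step_context: "swap_step s t \<Longrightarrow> swap_step (a @ s @ b) (a @ t @ b)"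
  unfolding swap_step_def by (metis append.assoc)

lemma swap_eq_context: "s \<rightleftharpoons> t \<Longrightarrow> a @ s @ b \<rightleftharpoons> a @ t @ b"
  by (induction rule: rtranclp_induct)
    (auto dest: swap_step_context[of _ _ a b] intro: rtranclp.rtrancl_into_rtrancl)

lemma swap_eq_append: "s \<rightleftharpoons> s' \<Longrightarrow> t \<rightleftharpoons> t' \<Longrightarrow> s @ t \<rightleftharpoons> s' @ t'"
  using swap_eq_context[of s s' "[]" t] swap_eq_context[of t t' s' "[]"]
  by (simp add: rtranclp_trans)

lemma swap_eq_swap: "swap e f f' e' \<Longrightarrow> a @ [e, f] @ b \<rightleftharpoons> a @ [f', e'] @ b"
  unfolding swap_step_def by (intro r_into_rtranclp) blast

lemma swap_eq_length: "s \<rightleftharpoons> t \<Longrightarrow> length s = length t"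
  by (induction rule: rtranclp_induct) (auto simp: swap_step_def)

lemma swap_flip: "swap e f f' e' \<Longrightarrow> swap (flip f) (flip e) (flip e') (flip f')"
  by (meson swap_sym swap_turn)

text \<open>
Whenever a word can be brought by exchanges to end with \<open>e\<close> or with a different letter \<open>f\<close>, the two
final letters are exchangeable with each other. Exchanges away from the end do not matter; two
successive changes of the last letter combine to one by the cube condition, and the induction
hypothesis on shorter words supplies the third square of the cube.
\<close>
lemma swap_eq_last:
  "s @ [e] \<rightleftharpoons> t @ [f] \<Longrightarrow>
     e = f \<and> s \<rightleftharpoons> t \<or> (\<exists>r e1 f1. s \<rightleftharpoons> r @ [f1] \<and> t \<rightleftharpoons> r @ [e1] \<and> swap f1 e e1 f)"
proof (induction "length s" arbitrary: s e t f rule: less_induct)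
  case less
  let ?P = "\<lambda>t f. e = f \<and> s \<rightleftharpoons> t \<or>
    (\<exists>r e1 f1. s \<rightleftharpoons> r @ [f1] \<and> t \<rightleftharpoons> r @ [e1] \<and> swap f1 e e1 f)"
  have "\<And>t f. w = t @ [f] \<Longrightarrow> ?P t f" if "s @ [e] \<rightleftharpoons> w" for w
    using that
  proof (induction rule: rtranclp_induct)
    case base
    then show ?case by auto
  next
    case (step w1 w2)
    obtain t f where w1: "w1 = t @ [f]"
      using swap_eq_length[OF step.hyps(1)] by (cases w1 rule: rev_cases) auto
    have tf: "?P t f" using step.IH w1 by blast
    obtain a b x y y' x' where ab: "w1 = a @ [x, y] @ b" "w2 = a @ [y', x'] @ b" "swap x y y' x'"
      using step.hyps(2) unfolding swap_step_def by blast
    show ?case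
    proof (cases b rule: rev_cases)
      case (snoc b' z)
      then have t: "t = a @ [x, y] @ b'" and z: "f = z" using ab(1) w1 by auto
      have t': "a @ [y', x'] @ b' \<rightleftharpoons> t"
        unfolding t by (rule swap_eq_sym[OF swap_eq_swap[OF ab(3)]])
      from tf have "?P (a @ [y', x'] @ b') z"
      proof (elim disjE exE conjE)
        assume "e = f" "s \<rightleftharpoons> t"
        then show ?thesis using z swap_eq_trans[OF _ swap_eq_sym[OF t']] by blast
      next
        fix r e1 f1 assume "s \<rightleftharpoons> r @ [f1]" "t \<rightleftharpoons> r @ [e1]" "swap f1 e e1 f"
        then show ?thesis using z swap_eq_trans[OF t'] by blast
      qed
      then show ?thesis using ab(2) snoc step.prems by auto
    next
      case Nil
      then have t: "t = a @ [x]" and f: "f = y" and w2: "w2 = (a @ [y']) @ [x']"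
        using ab w1 by auto
      have "?P (a @ [y']) x'"
      proof (cases "e = f \<and> s \<rightleftharpoons> t")
        case True
        then show ?thesis using t f ab(3) by blast
      next
        case False
        then obtain r e1 f1 where r: "s \<rightleftharpoons> r @ [f1]" "t \<rightleftharpoons> r @ [e1]" "swap f1 e e1 f"
          using tf by blast
        \<comment> \<open>Both descriptions of \<open>t\<close> end with squares; compare their letters before the last.\<close>
        have len: "length r < length s" using swap_eq_length[OF r(1)] by simp
        have "r @ [e1] \<rightleftharpoons> a @ [x]" using r(2) t swap_eq_sym by simp
        from less.hyps[OF len this] show ?thesis
        proof (elim disjE exE conjE)
          assume *: "e1 = x" "r \<rightleftharpoons> a"
          have "y' = f1 \<and> x' = e"
            using swap_unique ab(3) swap_sym[OF r(3)] *(1) f by blast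
          then show ?thesis
            using r(1) swap_eq_append[OF *(2), of "[f1]" "[f1]"] by (auto intro: rtranclp_trans)
        next
          fix c x1 z assume *: "r \<rightleftharpoons> c @ [z]" "a \<rightleftharpoons> c @ [x1]" "swap z e1 x1 x"
          obtain p q u where cube: "swap z f1 p q" "swap q e u x'" "swap x1 y' p u"
            using swap_cube[OF *(3) swap_sym[OF r(3)] ab(3)[folded f]] by blast
          have "s \<rightleftharpoons> c @ [z, f1]"
            using r(1) swap_eq_append[OF *(1), of "[f1]" "[f1]"] by (auto intro: rtranclp_trans)
          also have "c @ [z, f1] \<rightleftharpoons> c @ [p, q]"
            using swap_eq_swap[OF cube(1), of c "[]"] by simp
          finally have s: "s \<rightleftharpoons> (c @ [p]) @ [q]" by simp
          have "a @ [y'] \<rightleftharpoons> c @ [x1, y']"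
            using swap_eq_append[OF *(2), of "[y']" "[y']"] by auto
          also have "c @ [x1, y'] \<rightleftharpoons> c @ [p, u]"
            using swap_eq_swap[OF cube(3), of c "[]"] by simp
          finally have "a @ [y'] \<rightleftharpoons> (c @ [p]) @ [u]" by simp
          with s cube(2) show ?thesis by blast
        qed
      qed
      then show ?thesis using w2 step.prems by auto
    qed
  qed
  from this[OF less.prems] show ?case by simp
qed

lemma swap_eq_same_last: "s @ [e] \<rightleftharpoons> t @ [e] \<Longrightarrow> s \<rightleftharpoons> t"
  using swap_eq_last swap_neq(2) by blast

section \<open>Reduced words and normal forms\<close>

definition reduced :: "'e list \<Rightarrow> bool" where
  "reduced s \<longleftrightarrow> (\<nexists>a e b. s \<rightleftharpoons> a @ [e, flip e] @ b)"

lemma reduced_swap_eq: "s \<rightleftharpoons> t \<Longrightarrow> reduced s \<longleftrightarrow> reduced t"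
  unfolding reduced_def using swap_eq_left swap_eq_trans by blast

lemma reduced_prefix: "reduced (s @ t) \<Longrightarrow> reduced s"
  unfolding reduced_def using swap_eq_append[of s _ t t] by fastforce

lemma reduced_Nil [simp]: "reduced []"
  unfolding reduced_def using swap_eq_length by fastforce

lemma not_swap_eq_cancel: "reduced s \<Longrightarrow> \<not> s \<rightleftharpoons> a @ [e, flip e]"
  unfolding reduced_def by (metis append_Nil2 append.assoc)

lemma not_swap_eq_cancel': "reduced s \<Longrightarrow> \<not> s \<rightleftharpoons> a @ [flip e, e]"
  using not_swap_eq_cancel[of s a "flip e"] by simp

lemma swap_eq_last_trans: "s \<rightleftharpoons> r @ [x] \<Longrightarrow> r \<rightleftharpoons> r' @ [y] \<Longrightarrow> s \<rightleftharpoons> r' @ [y, x]"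
  using swap_eq_append[of r "r' @ [y]" "[x]" "[x]"] by (auto intro: rtranclp_trans)

lemma swap_eq_last_swap: "s \<rightleftharpoons> r @ [x, y] \<Longrightarrow> swap x y y' x' \<Longrightarrow> s \<rightleftharpoons> r @ [y', x']"
  using swap_eq_swap[of x y y' x' r "[]"] by (auto intro: rtranclp_trans)

text \<open>
Appending a letter creates a cancellation only at the very end. A cancelling pair elsewhere in
\<open>s @ [e]\<close> can be followed back to \<open>s\<close> through the squares given by \<open>swap_eq_last\<close>.
\<close>
lemma reduced_snoc:
  "reduced s \<Longrightarrow> \<nexists>s'. s \<rightleftharpoons> s' @ [flip e] \<Longrightarrow> reduced (s @ [e])"
proof (induction "length s" arbitrary: s e rule: less_induct)
  case less
  have no: "\<not> s \<rightleftharpoons> a @ [flip e]" for a using less.prems(2) by blast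
  show ?case
    unfolding reduced_def
  proof (intro notI, elim exE)
    fix a f b assume cancel: "s @ [e] \<rightleftharpoons> a @ [f, flip f] @ b"
    show False
    proof (cases b rule: rev_cases)
      case Nil
      then have "s @ [e] \<rightleftharpoons> (a @ [f]) @ [flip f]" using cancel by simp
      from swap_eq_last[OF this] show False
      proof (elim disjE exE conjE)
        assume "e = flip f" "s \<rightleftharpoons> a @ [f]"
        then show False using no by simp
      next
        fix r e1 f1 assume 1: "s \<rightleftharpoons> r @ [f1]" "a @ [f] \<rightleftharpoons> r @ [e1]" "swap f1 e e1 (flip f)"
        from swap_eq_last[OF 1(2)] show False
        proof (elim disjE exE conjE)
          assume "f = e1"
          then show False using not_swap_flip swap_sym[OF 1(3)] by blast
        next
          fix c f2 e2 assume 2: "a \<rightleftharpoons> c @ [e2]" "r \<rightleftharpoons> c @ [f2]" "swap e2 f f2 e1"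
          have "f1 = flip f2"
            using swap_unique[OF swap_sym[OF 1(3)] swap_sym[OF swap_turn[OF swap_sym[OF 2(3)]]]]
            by simp
          then show False
            using swap_eq_last_trans[OF 1(1) 2(2)] not_swap_eq_cancel less.prems(1) by blast
        qed
      qed
    next
      case (snoc b' g)
      then have "s @ [e] \<rightleftharpoons> (a @ [f, flip f] @ b') @ [g]" using cancel by simp
      from swap_eq_last[OF this] show False
      proof (elim disjE exE conjE)
        assume "s \<rightleftharpoons> a @ [f, flip f] @ b'"
        then show False using less.prems(1) unfolding reduced_def by blast
      next
        fix r e1 f1 assume 1: "s \<rightleftharpoons> r @ [f1]" "a @ [f, flip f] @ b' \<rightleftharpoons> r @ [e1]" "swap f1 e e1 g"
        have r: "reduced r" using less.prems(1) reduced_swap_eq[OF 1(1)] reduced_prefix by blast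
        have len: "length r < length s" using swap_eq_length[OF 1(1)] by simp
        have "\<not> reduced (r @ [e1])"
          unfolding reduced_def using swap_eq_sym[OF 1(2)] by blast
        then obtain r' where "r \<rightleftharpoons> r' @ [flip e1]" using less.hyps[OF len r] by blast
        from swap_eq_last_swap[OF swap_eq_last_trans[OF 1(1) this]
            swap_turn[OF swap_sym[OF 1(3)]]]
        have "s \<rightleftharpoons> (r' @ [g]) @ [flip e]" by simp
        then show False using no by blast
      qed
    qed
  qed
qed

text \<open>
The right action of a letter on reduced words, well defined up to exchanges.
\<close>
definition push :: "'e list \<Rightarrow> 'e \<Rightarrow> 'e list" where
  "push s e = (if \<exists>s'. s \<rightleftharpoons> s' @ [flip e] then SOME s'. s \<rightleftharpoons> s' @ [flip e] else s @ [e])"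

lemma push_cancel: 
  assumes "s \<rightleftharpoons> s' @ [flip e]"
  shows "push s e \<rightleftharpoons> s'" "s \<rightleftharpoons> push s e @ [flip e]"
proof -
  show 1: "s \<rightleftharpoons> push s e @ [flip e]"
    using someI[of "\<lambda>s'. s \<rightleftharpoons> s' @ [flip e]", OF assms] assms by (auto simp: push_def)
  show "push s e \<rightleftharpoons> s'"
    by (rule swap_eq_same_last) (rule swap_eq_left[OF 1 assms])
qed

lemma push_snoc: "\<nexists>s'. s \<rightleftharpoons> s' @ [flip e] \<Longrightarrow> push s e = s @ [e]"
  by (simp add: push_def)

lemma push_cong:
  assumes "s \<rightleftharpoons> t"
  shows "push s e \<rightleftharpoons> push t e"
proof (cases "\<exists>s'. s \<rightleftharpoons> s' @ [flip e]")
  case True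
  then obtain s' where "s \<rightleftharpoons> s' @ [flip e]" by blast
  moreover from this have "t \<rightleftharpoons> s' @ [flip e]" using assms swap_eq_left by blast
  ultimately show ?thesis using push_cancel(1) swap_eq_trans swap_eq_sym by blast
next
  case False
  then have "\<nexists>s'. t \<rightleftharpoons> s' @ [flip e]" using swap_eq_trans[OF assms] by blast
  with False show ?thesis using assms by (simp add: push_snoc swap_eq_append)
qed

lemma reduced_push: "reduced s \<Longrightarrow> reduced (push s e)"
  by (cases "\<exists>s'. s \<rightleftharpoons> s' @ [flip e]")
    (use reduced_swap_eq[OF push_cancel(2)] reduced_prefix in blast, simp add: push_snoc reduced_snoc)

lemma push_flip:
  assumes "reduced s"
  shows "push (push s e) (flip e) \<rightleftharpoons> s"
proof (cases "\<exists>s'. s \<rightleftharpoons> s' @ [flip e]")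
  case True
  then obtain s' where s': "s \<rightleftharpoons> s' @ [flip e]" by blast
  have "\<not> push s e \<rightleftharpoons> r @ [e]" for r
    using swap_eq_last_trans[OF push_cancel(2)[OF s'], of r e] assms not_swap_eq_cancel by blast
  then have "push (push s e) (flip e) = push s e @ [flip e]" by (simp add: push_snoc)
  then show ?thesis using push_cancel(2)[OF s', THEN swap_eq_sym] by simp
next
  case False
  have "s @ [e] \<rightleftharpoons> s @ [flip (flip e)]" by simp
  from push_cancel(1)[OF this] False show ?thesis by (simp add: push_snoc)
qed

text \<open>
Both sides of a square act in the same way on reduced words. Here one of the two paths starts with
a cancellation; \<open>push_swap\<close> adds the case where neither does.
\<close>
lemma push_swap_cancel:
  assumes "reduced s" "swap e f f' e'" "s \<rightleftharpoons> s1 @ [flip e]"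
  shows "push (push s e) f \<rightleftharpoons> push (push s f') e'"
proof -
  have eq: "push (push s e) f \<rightleftharpoons> push s1 f" using push_cancel(1)[OF assms(3)] by (rule push_cong)
  show ?thesis
  proof (cases "\<exists>s2. s1 \<rightleftharpoons> s2 @ [flip f]")
    case True
    then obtain s2 where s2: "s1 \<rightleftharpoons> s2 @ [flip f]" by blast
    from swap_eq_last_swap[OF swap_eq_last_trans[OF assms(3) s2] swap_flip[OF assms(2)]]
    have "s \<rightleftharpoons> (s2 @ [flip e']) @ [flip f']" by simp
    from push_cancel(1)[OF this] have "push (push s f') e' \<rightleftharpoons> push (s2 @ [flip e']) e'"
      by (rule push_cong)
    also have "\<dots> \<rightleftharpoons> s2" by (rule push_cancel(1)) simp
    also have "s2 \<rightleftharpoons> push (push s e) f"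
      by (rule swap_eq_trans[OF swap_eq_sym[OF push_cancel(1)[OF s2]] swap_eq_sym[OF eq]])
    finally show ?thesis by (rule swap_eq_sym)
  next
    case False
    have no: "\<nexists>s3. s \<rightleftharpoons> s3 @ [flip f']"
    proof
      assume "\<exists>s3. s \<rightleftharpoons> s3 @ [flip f']"
      then obtain s3 where "s \<rightleftharpoons> s3 @ [flip f']" by blast
      then have "s1 @ [flip e] \<rightleftharpoons> s3 @ [flip f']" using assms(3) by (rule swap_eq_left[rotated])
      from swap_eq_last[OF this] show False
      proof (elim disjE exE conjE)
        assume "flip e = flip f'"
        then show False using swap_neq(1)[OF assms(2)] by (metis flip_flip)
      next
        fix r e1 f1 assume 1: "s1 \<rightleftharpoons> r @ [f1]" "swap f1 (flip e) e1 (flip f')"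
        have "flip f1 = f"
          using swap_unique[OF swap_turn[OF assms(2)]] swap_sym[OF swap_turn[OF 1(2)]] by simp
        then have "f1 = flip f" by auto
        then show False using False 1(1) by blast
      qed
    qed
    have "s @ [f'] \<rightleftharpoons> (s1 @ [flip e]) @ [f']" using assms(3) swap_eq_append by blast
    then have "s @ [f'] \<rightleftharpoons> s1 @ [f, flip e']"
      using swap_eq_last_swap[OF _ swap_turn[OF assms(2)]] by simp
    then have "push (s @ [f']) e' \<rightleftharpoons> s1 @ [f]" using push_cancel(1) by simp
    then have "push (push s f') e' \<rightleftharpoons> push s1 f" using no False by (simp add: push_snoc)
    then show ?thesis by (rule swap_eq_trans[OF eq swap_eq_sym])
  qed
qed

text \<open>
If neither \<open>e\<close> nor \<open>f'\<close> cancels against \<open>s\<close>, then the second letters do not cancel either, since a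
cancellation of \<open>f\<close> against \<open>s @ [e]\<close> comes from one of \<open>f'\<close> against \<open>s\<close>, and conversely.
\<close>
lemma push_swap:
  assumes "reduced s" "swap e f f' e'"
  shows "push (push s e) f \<rightleftharpoons> push (push s f') e'"
proof (cases "(\<exists>s1. s \<rightleftharpoons> s1 @ [flip e]) \<or> (\<exists>s1. s \<rightleftharpoons> s1 @ [flip f'])")
  case True
  then show ?thesis
    using push_swap_cancel[OF assms] push_swap_cancel[OF assms(1) swap_sym[OF assms(2)]]
      swap_eq_sym by blast
next
  case False
  have no: "\<nexists>t. s @ [e] \<rightleftharpoons> t @ [flip f]"
    if "swap e f f' e'" "\<nexists>s1. s \<rightleftharpoons> s1 @ [flip f']" for e f f' e'
  proof
    assume "\<exists>t. s @ [e] \<rightleftharpoons> t @ [flip f]"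
    then obtain t where "s @ [e] \<rightleftharpoons> t @ [flip f]" by blast
    from swap_eq_last[OF this] show False
    proof (elim disjE exE conjE)
      assume "e = flip f"
      then show False using that(1) not_swap_flip by (metis flip_flip)
    next
      fix r e1 f1 assume 1: "s \<rightleftharpoons> r @ [f1]" "swap f1 e e1 (flip f)"
      have "flip f1 = f'"
        using swap_unique[OF that(1)] swap_sym[OF swap_turn[OF 1(2)]] by simp
      then have "f1 = flip f'" by auto
      then show False using that(2) 1(1) by blast
    qed
  qed
  show ?thesis
    using False no[OF assms(2)] no[OF swap_sym[OF assms(2)]] swap_eq_swap[OF assms(2), of s "[]"]
    by (simp add: push_snoc)
qed

text \<open>
The action of a word on the empty word. All relations of the group are respected by \<open>push\<close>, so this
separates the elements of the group.
\<close>
definition normal_form :: "'e list \<Rightarrow> 'e list" where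
  "normal_form s = foldl push [] s"

lemma foldl_push_cong: "s \<rightleftharpoons> t \<Longrightarrow> foldl push s u \<rightleftharpoons> foldl push t u"
  by (induction u arbitrary: s t) (auto intro: push_cong)

lemma reduced_foldl_push: "reduced s \<Longrightarrow> reduced (foldl push s u)"
  by (induction u arbitrary: s) (auto intro: reduced_push)

lemma reduced_normal_form: "reduced (normal_form s)"
  unfolding normal_form_def by (simp add: reduced_foldl_push)

text \<open>
No cancellation happens along the way, so the word itself is returned, without any exchange.
\<close>
lemma normal_form_reduced: "reduced s \<Longrightarrow> normal_form s = s"
proof (induction s rule: rev_induct)
  case (snoc e s)
  have "\<not> s \<rightleftharpoons> s' @ [flip e]" for s'
    using snoc.prems swap_eq_append[of s "s' @ [flip e]" "[e]" "[e]"] not_swap_eq_cancel' by fastforce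
  then have "push s e = s @ [e]" by (simp add: push_snoc)
  then show ?case using snoc reduced_prefix by (simp add: normal_form_def)
qed (simp add: normal_form_def)

inductive cancels :: "'e list \<Rightarrow> 'e list \<Rightarrow> bool" where
  "cancels (a @ [e, flip e] @ b) (a @ b)"

definition reduction_step :: "'e list \<Rightarrow> 'e list \<Rightarrow> bool" where
  "reduction_step s t \<longleftrightarrow> swap_step s t \<or> cancels s t"

abbreviation reduces :: "'e list \<Rightarrow> 'e list \<Rightarrow> bool" where
  "reduces \<equiv> reduction_step\<^sup>*\<^sup>*"

abbreviation equal_words :: "'e list \<Rightarrow> 'e list \<Rightarrow> bool" (infix "\<asymp>" 50) where
  "(\<asymp>) \<equiv> equivclp reduction_step"

lemma cancels_context: "cancels s t \<Longrightarrow> cancels (a @ s @ b) (a @ t @ b)"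
proof (induction rule: cancels.induct)
  case (1 c e d)
  show ?case using cancels.intros[of "a @ c" e "d @ b"] by simp
qed

lemma reduction_step_context:
  "reduction_step s t \<Longrightarrow> reduction_step (a @ s @ b) (a @ t @ b)"
  unfolding reduction_step_def using swap_step_context cancels_context by blast

lemma reduces_append: "reduces s t \<Longrightarrow> reduces (s @ u) (t @ u)"
proof (induction rule: rtranclp_induct)
  case (step y z)
  from reduction_step_context[OF step.hyps(2), of "[]" u] step.IH show ?case
    by (simp add: rtranclp.rtrancl_into_rtrancl)
qed simp

lemma swap_eq_reduces: "s \<rightleftharpoons> t \<Longrightarrow> reduces s t"
  by (rule rtranclp_mono[THEN predicate2D]) (auto simp: reduction_step_def)

lemma reduces_normal_form: "reduces s (normal_form s)"
proof (induction s rule: rev_induct)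
  case (snoc e s)
  have 1: "reduces (s @ [e]) (normal_form s @ [e])" using snoc reduces_append by blast
  have "reduces (normal_form s @ [e]) (push (normal_form s) e)"
  proof (cases "\<exists>s'. normal_form s \<rightleftharpoons> s' @ [flip e]")
    case True
    let ?p = "push (normal_form s) e"
    have "normal_form s \<rightleftharpoons> ?p @ [flip e]" using True push_cancel(2) by blast
    from swap_eq_reduces[OF swap_eq_append[OF this, of "[e]" "[e]"]]
    have "reduces (normal_form s @ [e]) (?p @ [flip e, e])" by simp
    moreover have "cancels (?p @ [flip e, e]) ?p" using cancels.intros[of ?p "flip e" "[]"] by simp
    ultimately show ?thesis by (simp add: reduction_step_def rtranclp.rtrancl_into_rtrancl)
  qed (simp add: push_snoc)
  with 1 show ?case by (simp add: normal_form_def)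
qed (simp add: normal_form_def)

lemma reduces_equal: "reduces s t \<Longrightarrow> s \<asymp> t"
  by (rule rtranclp_into_equivclp)

lemma equal_context: "s \<asymp> t \<Longrightarrow> a @ s @ b \<asymp> a @ t @ b"
proof (induction rule: equivclp_induct)
  case (step y z)
  then have "reduction_step (a @ y @ b) (a @ z @ b) \<or> reduction_step (a @ z @ b) (a @ y @ b)"
    using reduction_step_context by blast
  then show ?case by (rule equivclp_into_equivclp[OF step.IH])
qed simp

lemma equal_append: "s \<asymp> s' \<Longrightarrow> t \<asymp> t' \<Longrightarrow> s @ t \<asymp> s' @ t'"
  using equal_context[of s s' "[]" t] equal_context[of t t' s' "[]"]
  by (simp add: equivclp_trans)

lemma normal_form_cong:
  assumes "s \<asymp> t"
  shows "normal_form s \<rightleftharpoons> normal_form t"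
  using assms
proof (induction rule: equivclp_induct)
  case (step y z)
  have one: "normal_form s \<rightleftharpoons> normal_form t" if "reduction_step s t" for s t
    using that unfolding reduction_step_def
  proof (elim disjE)
    assume "swap_step s t"
    then obtain a b e f f' e' where "s = a @ [e, f] @ b" "t = a @ [f', e'] @ b" "swap e f f' e'"
      unfolding swap_step_def by blast
    then show ?thesis
      using foldl_push_cong[OF push_swap[OF reduced_normal_form]] by (simp add: normal_form_def)
  next
    assume "cancels s t"
    then obtain a e b where "s = a @ [e, flip e] @ b" "t = a @ b" by cases
    then show ?thesis
      using foldl_push_cong[OF push_flip[OF reduced_normal_form]] by (simp add: normal_form_def)
  qed
  have "normal_form y \<rightleftharpoons> normal_form z" using step.hyps(2) one swap_eq_sym[OF one] by (elim disjE)
  then show ?case by (rule swap_eq_trans[OF step.IH])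
qed simp

lemma reduces_length: "reduces s t \<Longrightarrow> length t \<le> length s"
proof (induction rule: rtranclp_induct)
  case (step y z)
  then have "length z \<le> length y" by (auto simp: reduction_step_def swap_step_def elim: cancels.cases)
  with step show ?case by simp
qed simp

lemma length_normal_form_le: "s \<asymp> t \<Longrightarrow> length (normal_form s) \<le> length t"
  using swap_eq_length[OF normal_form_cong] reduces_length[OF reduces_normal_form[of t]] by metis

lemma equal_normal_form: "s \<asymp> normal_form s"
  using reduces_normal_form reduces_equal by blast

text \<open>
A trivial word can be emptied by exchanges and cancellations alone, without insertions. This is
what makes it possible to contract the path that the word comes from.
\<close>
lemma equal_Nil_reduces: "s \<asymp> [] \<Longrightarrow> reduces s []"
  using reduces_normal_form[of s] swap_eq_length[OF normal_form_cong[of s "[]"]] by (simp add: normal_form_def)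

lemma equal_trans [trans]: "s \<asymp> t \<Longrightarrow> t \<asymp> u \<Longrightarrow> s \<asymp> u"
  by (rule equivclp_trans)

lemma equal_sym: "s \<asymp> t \<Longrightarrow> t \<asymp> s"
  by (rule equivclp_sym)

lemma swap_eq_equal: "s \<rightleftharpoons> t \<Longrightarrow> s \<asymp> t"
  using swap_eq_reduces reduces_equal by blast

lemma equal_cancel: "a @ [e, flip e] @ b \<asymp> a @ b"
  using cancels.intros by (intro r_into_equivclp) (simp add: reduction_step_def del: append_Cons)

section \<open>Inverses, powers and conjugates of words\<close>

definition inverse_word :: "'e list \<Rightarrow> 'e list" where
  "inverse_word s = rev (map flip s)"

lemma length_inverse_word [simp]: "length (inverse_word s) = length s"
  by (simp add: inverse_word_def)

lemma inverse_word_inverse_word [simp]: "inverse_word (inverse_word s) = s"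
  by (simp add: inverse_word_def rev_map o_def)

lemma equal_inverse_right: "s @ inverse_word s \<asymp> []"
proof (induction s)
  case (Cons e s)
  have "(e # s) @ inverse_word (e # s) = [e] @ (s @ inverse_word s) @ [flip e]"
    by (simp add: inverse_word_def)
  also have "\<dots> \<asymp> [e] @ [] @ [flip e]" by (rule equal_context[OF Cons])
  also have "\<dots> \<asymp> []" using equal_cancel[of "[]" e "[]"] by simp
  finally show ?case .
qed (simp add: inverse_word_def)

lemma equal_inverse_left: "inverse_word s @ s \<asymp> []"
  using equal_inverse_right[of "inverse_word s"] by simp

lemma equal_move_left:
  assumes "a @ s \<asymp> t"
  shows "s \<asymp> inverse_word a @ t"
proof -
  have "s \<asymp> (inverse_word a @ a) @ s"
    using equal_append[OF equal_sym[OF equal_inverse_left[of a]], of s s] by simp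
  also have "\<dots> = inverse_word a @ (a @ s) @ []" by simp
  also have "\<dots> \<asymp> inverse_word a @ t @ []" by (rule equal_context[OF assms])
  finally show ?thesis by simp
qed

lemma equal_move_right:
  assumes "s @ a \<asymp> t"
  shows "s \<asymp> t @ inverse_word a"
proof -
  have "s \<asymp> s @ (a @ inverse_word a)"
    using equal_append[OF _ equal_sym[OF equal_inverse_right[of a]], of s s] by simp
  also have "\<dots> = [] @ (s @ a) @ inverse_word a" by simp
  also have "\<dots> \<asymp> [] @ t @ inverse_word a" by (rule equal_context[OF assms])
  finally show ?thesis by simp
qed

definition power_word :: "nat \<Rightarrow> 'e list \<Rightarrow> 'e list" where
  "power_word n s = concat (replicate n s)"

lemma power_word_0 [simp]: "power_word 0 s = []"
  and power_word_Suc [simp]: "power_word (Suc n) s = s @ power_word n s"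
  by (simp_all add: power_word_def)

lemma power_word_add: "power_word (m + n) s = power_word m s @ power_word n s"
  by (induction m) auto

lemma power_word_mult: "power_word (m * n) s = power_word m (power_word n s)"
  by (induction m) (auto simp: power_word_add)

lemma power_word_cong: "s \<asymp> t \<Longrightarrow> power_word n s \<asymp> power_word n t"
  by (induction n) (auto intro: equal_append)

lemma power_word_conjugate: 
  assumes "s \<asymp> a @ u @ inverse_word a"
  shows "power_word n s \<asymp> a @ power_word n u @ inverse_word a"
proof (induction n)
  case 0
  then show ?case using equal_sym[OF equal_inverse_right[of a]] by simp
next
  case (Suc n)
  have "power_word (Suc n) s \<asymp>
      (a @ u @ inverse_word a) @ (a @ power_word n u @ inverse_word a)"
    using equal_append[OF assms Suc] by simp
  also have "\<dots> = (a @ u) @ (inverse_word a @ a) @ (power_word n u @ inverse_word a)" by simp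
  also have "\<dots> \<asymp> (a @ u) @ [] @ (power_word n u @ inverse_word a)"
    by (rule equal_context[OF equal_inverse_left])
  finally show ?case by simp
qed

text \<open>
Successive letters with property \<open>P\<close> in a power of \<open>z # s\<close> are at most one period apart because \<open>z\<close>
has the property: they lie in one period, or the second one is the \<open>z\<close> that starts the next period.
\<close>
lemma pair_in_power_word:
  "power_word n (z # s) = a @ x # b @ y # c \<Longrightarrow> P z \<Longrightarrow> \<forall>e\<in>set b. \<not> P e \<Longrightarrow>
     (\<exists>a c. z # s = a @ x # b @ y # c) \<or> (\<exists>a. z # s = a @ x # b) \<and> y = z"
proof (induction n arbitrary: a)
  case (Suc n)
  let ?s = "z # s" and ?R = "power_word n (z # s)"
  have hd: "y' = z" if "?R = y' # c'" for y' c'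
    using that by (cases n) auto
  have "?s @ ?R = (a @ x # b) @ y # c" using Suc.prems(1) by simp
  then consider u where "?s = (a @ x # b) @ u" "u @ ?R = y # c"
    | u where "?s @ u = a @ x # b" "?R = u @ y # c"
    unfolding append_eq_append_conv2 by blast
  then show ?case
  proof cases
    case (1 u)
    then show ?thesis using hd by (cases u) auto
  next
    case (2 u)
    from 2(1) consider v where "?s = a @ v" "v @ u = x # b" | v where "?s @ v = a" "u = v @ x # b"
      unfolding append_eq_append_conv2 by blast
    then show ?thesis
    proof cases
      case (1 v)
      show ?thesis
      proof (cases v)
        case Nil
        then show ?thesis using 1 2(2) Suc.IH[of "[]"] Suc.prems by simp
      next
        case (Cons x' b1)
        then have b: "b = b1 @ u" "x' = x" using 1 by auto
        show ?thesis
        proof (cases u)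
          case Nil
          then show ?thesis using b 1 Cons 2(2) hd by auto
        next
          case (Cons e u')
          then show ?thesis using hd 2(2) b(1) Suc.prems by auto
        qed
      qed
    next
      case (2 v)
      then show ?thesis using \<open>?R = _\<close> Suc.IH[of v] Suc.prems by simp
    qed
  qed
qed simp

text \<open>
Translation length at least 1 in the word metric. The constant makes the property invariant under
conjugation; \<open>grows_imp_length_ge\<close> removes it again.
\<close>
definition grows :: "'e list \<Rightarrow> bool" where
  "grows s \<longleftrightarrow> (\<exists>c. \<forall>n t. power_word n s \<asymp> t \<longrightarrow> n \<le> length t + c)"

lemma grows_conjugate:
  assumes "grows u" "s \<asymp> a @ u @ inverse_word a"
  shows "grows s"
proof -
  obtain c where c: "\<And>n t. power_word n u \<asymp> t \<Longrightarrow> n \<le> length t + c"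
    using assms(1) unfolding grows_def by blast
  have "n \<le> length t + (2 * length a + c)" if "power_word n s \<asymp> t" for n t
  proof -
    have "a @ (power_word n u @ inverse_word a) \<asymp> t"
      using power_word_conjugate[OF assms(2)] that equal_trans equal_sym by blast
    from equal_move_right[OF equal_move_left[OF this]]
    have "power_word n u \<asymp> inverse_word a @ t @ a" by simp
    from c[OF this] show ?thesis by simp
  qed
  then show ?thesis unfolding grows_def by blast
qed

lemma grows_imp_length_ge:
  assumes "grows s" "power_word n s \<asymp> t"
  shows "n \<le> length t"
proof (rule ccontr)
  assume "\<not> n \<le> length t"
  obtain c where c: "\<And>n t. power_word n s \<asymp> t \<Longrightarrow> n \<le> length t + c"
    using assms(1) unfolding grows_def by blast
  \<comment> \<open>A defect of at least one letter adds up to more than \<open>c\<close> in the power \<open>Suc c\<close>.\<close>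
  have "power_word (Suc c * n) s \<asymp> power_word (Suc c) t"
    unfolding power_word_mult by (rule power_word_cong[OF assms(2)])
  then have "Suc c * n \<le> length (power_word (Suc c) t) + c" by (rule c)
  also have "length (power_word (Suc c) t) = Suc c * length t"
    by (simp add: power_word_def length_concat sum_list_replicate)
  finally have "Suc c * n \<le> Suc c * length t + c" .
  moreover have "Suc c * Suc (length t) \<le> Suc c * n"
    using \<open>\<not> n \<le> length t\<close> by (intro mult_le_mono) auto
  ultimately show False by simp
qed

end

section \<open>Moves on positions\<close>

text \<open>
In \<open>(i, l, d)\<close> the relation \<open>l\<close> is applied in direction \<open>d\<close>, its left end being at position \<open>i\<close>.
The interval that is replaced has length \<open>len l d\<close> before the move and \<open>len l (\<not> d)\<close> after it.
\<close>
type_synonym 'l move = "nat \<times> 'l \<times> bool"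

fun flip_move :: "'l move \<Rightarrow> 'l move" where
  "flip_move (i, l, d) = (i, l, \<not> d)"

fun raise_move :: "nat \<Rightarrow> 'l move \<Rightarrow> 'l move" where
  "raise_move k (i, l, d) = (i + k, l, d)"

abbreviation raise :: "nat \<Rightarrow> 'l move list \<Rightarrow> 'l move list" where
  "raise k \<equiv> map (raise_move k)"

definition lefts :: "'l move list \<Rightarrow> nat" where
  "lefts s = length (filter (\<lambda>e. fst e = 0) s)"

lemma lefts_append [simp]: "lefts (s @ t) = lefts s + lefts t"
  by (simp add: lefts_def)

lemma raise_flip_move: "flip_move (raise_move k e) = raise_move k (flip_move e)"
  by (cases e) auto

lemma inj_raise_move: "raise_move k e = raise_move k f \<longleftrightarrow> e = f"
  by (cases e; cases f) auto

lemma fst_raise_move [simp]: "fst (raise_move k e) = fst e + k"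
  by (cases e) auto

lemma fst_flip_move [simp]: "fst (flip_move e) = fst e"
  by (cases e) auto

lemma map_eq_append_pair:
  "map h s = a @ [x, y] @ b \<Longrightarrow>
     \<exists>a0 x0 y0 b0. s = a0 @ [x0, y0] @ b0 \<and> a = map h a0 \<and> x = h x0 \<and> y = h y0 \<and> b = map h b0"
  by (auto simp: map_eq_append_conv map_eq_Cons_conv)

text \<open>
The cube condition for three intervals at \<open>k\<close>, \<open>i\<close>, \<open>j\<close>, replaced in this order, with lengths
\<open>sn\<close>, \<open>sl\<close>, \<open>sm\<close> before and \<open>un\<close>, \<open>ul\<close>, \<open>um\<close> after the replacement. Pairwise exchangeable moves act
on disjoint intervals, so their left-to-right order is one of six; in each of them the positions after
all exchanges are determined.
\<close>
lemma cube_arith: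
  fixes i j k i1 i2 j1 j2 k1 k2 sl ul sm um sn un :: nat
  assumes pos: "0 < sl" "0 < ul" "0 < sm" "0 < um" "0 < sn" "0 < un"
    and ge: "k + un \<le> i \<and> i1 + un = i + sn \<and> k1 = k \<or> i + sl \<le> k \<and> i1 = i \<and> k1 + sl = k + ul"
    and ef: "i + ul \<le> j \<and> j1 + ul = j + sl \<and> i2 = i \<or> j + sm \<le> i \<and> j1 = j \<and> i2 + sm = i + um"
    and gf: "k1 + un \<le> j \<and> j2 + un = j + sn \<and> k2 = k1 \<or> j + sm \<le> k1 \<and> j2 = j \<and> k2 + sm = k1 + um"
  obtains j3 k3 i3 where
    "k + un \<le> j1 \<and> j3 + un = j1 + sn \<and> k3 = k \<or> j1 + sm \<le> k \<and> j3 = j1 \<and> k3 + sm = k + um"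
    "k3 + un \<le> i2 \<and> i3 + un = i2 + sn \<and> k2 = k3 \<or> i2 + sl \<le> k3 \<and> i3 = i2 \<and> k2 + sl = k3 + ul"
    "i1 + ul \<le> j2 \<and> j3 + ul = j2 + sl \<and> i3 = i1 \<or> j2 + sm \<le> i1 \<and> j3 = j2 \<and> i3 + sm = i1 + um"
proof -
  from ef consider "i + ul \<le> j" "j1 + ul = j + sl" "i2 = i" | "j + sm \<le> i" "j1 = j" "i2 + sm = i + um"
    by blast
  note e = this
  from gf consider "k1 + un \<le> j" "j2 + un = j + sn" "k2 = k1" | "j + sm \<le> k1" "j2 = j" "k2 + sm = k1 + um"
    by blast
  note g = this
  from ge show ?thesis
  proof (elim disjE conjE)
    assume ge: "k + un \<le> i" "i1 + un = i + sn" "k1 = k"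
    show ?thesis
    proof (cases rule: e)
      case 1
      define j3 where "j3 = j1 + sn - un"
      have "k + un \<le> j1" using ge 1 by linarith
      moreover from this have j3: "j3 + un = j1 + sn" unfolding j3_def by linarith
      moreover have "k1 + un \<le> j" "j2 + un = j + sn" "k2 = k1" using gf ge 1 pos by linarith+
      moreover from this have "i1 + ul \<le> j2" "j3 + ul = j2 + sl" using j3 ge 1 by linarith+
      ultimately show ?thesis using that[of j3 k i1] ge 1 by simp
    next
      case 2
      note fe = this
      define i3 where "i3 = i1 + um - sm"
      have i3: "i3 + sm = i1 + um \<and> i3 + un = i2 + sn" if "sm \<le> i1"
        unfolding i3_def using ge fe that by linarith
      show ?thesis
      proof (cases rule: g)
        case 1
        then have "j2 + sm \<le> i1" using ge fe by linarith
        then show ?thesis using that[of j2 k i3] i3 ge fe 1 by simp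
      next
        case 2
        then have "k2 + un \<le> i2" "j + sm \<le> i1" using ge fe by linarith+
        then show ?thesis using that[of j2 k2 i3] i3 ge fe 2 by simp
      qed
    qed
  next
    assume eg: "i + sl \<le> k" "i1 = i" "k1 + sl = k + ul"
    show ?thesis
    proof (cases rule: e)
      case 1
      note ef = this
      show ?thesis
      proof (cases rule: g)
        case 1
        have "k + un \<le> j1" "j1 - un + sn + un = j1 + sn" "i + ul \<le> j2" "j1 - un + sn + ul = j2 + sl"
          using eg ef 1 pos by linarith+
        then show ?thesis using that[of "j1 - un + sn" k i] eg ef 1 by simp
      next
        case 2
        define k3 where "k3 = k + um - sm"
        have "j1 + sm \<le> k" using eg ef 2 by linarith
        moreover from this have k3: "k3 + sm = k + um" unfolding k3_def by linarith
        moreover have "i + sl \<le> k3" "k2 + sl = k3 + ul" using k3 eg ef 2 pos by linarith+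
        ultimately show ?thesis using that[of j1 k3 i] eg ef 2 by simp
      qed
    next
      case 2
      define k3 where "k3 = k + um - sm"
      have fk: "j1 + sm \<le> k" using eg 2 by linarith
      then have k3: "k3 + sm = k + um" unfolding k3_def by linarith
      have "j + sm \<le> k1" "j2 = j" "k2 + sm = k1 + um" using gf eg 2 pos by linarith+
      moreover from this have "i2 + sl \<le> k3" "k2 + sl = k3 + ul" using k3 eg 2 by linarith+
      ultimately show ?thesis using that[of j1 k3 i2] fk k3 eg 2 by simp
    qed
  qed
qed

locale interval_moves =
  fixes len :: "'l \<Rightarrow> bool \<Rightarrow> nat"
  assumes len_pos: "0 < len l d"
begin

text \<open>
If the second interval lies to the right of the first one, its position was shifted by the first
move, and the exchange undoes the shift; if it lies to the left, the first move gets shifted instead.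
Sums instead of differences avoid truncated subtraction.
\<close>
fun exchange :: "'l move \<Rightarrow> 'l move \<Rightarrow> 'l move \<Rightarrow> 'l move \<Rightarrow> bool" where
  "exchange (i, l, d) (j, m, c) (j', m', c') (i', l', d') \<longleftrightarrow>
     m' = m \<and> c' = c \<and> l' = l \<and> d' = d \<and>
     (i + len l (\<not> d) \<le> j \<and> j' + len l (\<not> d) = j + len l d \<and> i' = i \<or>
      j + len m c \<le> i \<and> j' = j \<and> i' + len m c = i + len m (\<not> c))"

sublocale swap_system flip_move exchange
proof
  fix e f f' e' f'' e'' g e1 g1 f1 e2 f2 g2 :: "'l move"
  obtain i l d where e: "e = (i, l, d)" by (cases e)
  obtain j m c where f: "f = (j, m, c)" by (cases f)
  have pos: "0 < len l d" "0 < len l (\<not> d)" "0 < len m c" "0 < len m (\<not> c)"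
    by (rule len_pos)+
  show "flip_move (flip_move e) = e" by (simp add: e)
  show "exchange e f f' e' \<Longrightarrow> exchange f' e' e f"
    using pos by (cases f'; cases e'; auto simp: e f)
  show "exchange e f f' e' \<Longrightarrow> exchange e f f'' e'' \<Longrightarrow> f'' = f' \<and> e'' = e'"
    using pos by (cases f'; cases e'; cases f''; cases e''; auto simp: e f)
  show "exchange e f f' e' \<Longrightarrow> exchange (flip_move e) f' f (flip_move e')"
    by (cases f'; cases e'; auto simp: e f)
  show "\<not> exchange e (flip_move e) f' e'"
    using pos by (cases f'; cases e'; auto simp: e)
  show "exchange e f f' e' \<Longrightarrow> e \<noteq> f'" "exchange e f f' e' \<Longrightarrow> f \<noteq> e'"
    using pos by (cases f'; cases e'; auto simp: e f)+
  show "\<exists>f3 g3 e3. exchange g f1 f3 g3 \<and> exchange g3 e2 e3 g2 \<and> exchange e1 f2 f3 e3"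
    if 1: "exchange g e e1 g1" and 2: "exchange e f f1 e2" and 3: "exchange g1 f f2 g2"
  proof -
    obtain k n b where g: "g = (k, n, b)" by (cases g)
    obtain i1 k1 where ge: "e1 = (i1, l, d)" "g1 = (k1, n, b)"
      using 1 by (cases e1; cases g1) (simp add: e g)
    obtain j1 i2 where ef: "f1 = (j1, m, c)" "e2 = (i2, l, d)"
      using 2 by (cases f1; cases e2) (simp add: e f)
    obtain j2 k2 where gf: "f2 = (j2, m, c)" "g2 = (k2, n, b)"
      using 3 by (cases f2; cases g2) (simp add: f g ge)
    have "0 < len n b" "0 < len n (\<not> b)" by (rule len_pos)+
    note pos = pos this
    from 1 2 3 show ?thesis
      unfolding e f g ge ef gf exchange.simps
      apply (elim conjE)
      apply (rule cube_arith[OF pos]; assumption?)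
      subgoal for j3 k3 i3
        by (rule exI[of _ "(j3, m, c)"], rule exI[of _ "(k3, n, b)"], rule exI[of _ "(i3, l, d)"]) simp
      done
  qed
qed

notation swap_eq (infix "\<rightleftharpoons>" 50) and equal_words (infix "\<asymp>" 50)

lemma exchange_raise:
  "exchange (raise_move k e) (raise_move k f) (raise_move k f') (raise_move k e') \<longleftrightarrow> exchange e f f' e'"
  by (cases e; cases f; cases f'; cases e') auto

lemma exchange_raiseD:
  assumes "exchange (raise_move k e) (raise_move k f) f' e'"
  obtains f0 e0 where "f' = raise_move k f0" "e' = raise_move k e0" "exchange e f f0 e0"
proof -
  have "k \<le> fst f'" "k \<le> fst e'"
    using assms by (cases e; cases f; cases f'; cases e'; auto)+
  then have "f' = raise_move k (fst f' - k, snd f')" "e' = raise_move k (fst e' - k, snd e')"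
    by (cases f'; cases e'; auto)+
  then show ?thesis using that assms exchange_raise by metis
qed

lemma swap_step_raise: "swap_step s t \<Longrightarrow> swap_step (raise k s) (raise k t)"
  unfolding swap_step_def by (fastforce simp: exchange_raise)

lemma cancels_raise: "cancels s t \<Longrightarrow> cancels (raise k s) (raise k t)"
proof (induction rule: cancels.induct)
  case (1 a e b)
  show ?case
    using cancels.intros[of "raise k a" "raise_move k e" "raise k b"] by (simp add: raise_flip_move)
qed

lemma equal_raise: "s \<asymp> t \<Longrightarrow> raise k s \<asymp> raise k t"
proof (induction rule: equivclp_induct)
  case (step y z)
  then have "reduction_step (raise k y) (raise k z) \<or> reduction_step (raise k z) (raise k y)"
    using swap_step_raise cancels_raise unfolding reduction_step_def by blast
  then show ?case by (rule equivclp_into_equivclp[OF step.IH])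
qed simp

text \<open>
Exchanges cannot bring a move below the least position of the word.
\<close>
lemma swap_eq_raiseD: "raise k s \<rightleftharpoons> t \<Longrightarrow> \<exists>t'. t = raise k t' \<and> s \<rightleftharpoons> t'"
proof (induction rule: rtranclp_induct)
  case (step t u)
  then obtain t' where t': "t = raise k t'" "s \<rightleftharpoons> t'" by blast
  obtain a b e f f' e' where ab: "t = a @ [e, f] @ b" "u = a @ [f', e'] @ b" "exchange e f f' e'"
    using step.hyps(2) unfolding swap_step_def by blast
  from map_eq_append_pair[of "raise_move k" t' a e f b] ab(1) t'(1)
  obtain a0 e0 f0 b0 where 0: "t' = a0 @ [e0, f0] @ b0" "a = raise k a0" "e = raise_move k e0"
      "f = raise_move k f0" "b = raise k b0"
    by auto
  obtain f1 e1 where 1: "f' = raise_move k f1" "e' = raise_move k e1" "exchange e0 f0 f1 e1"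
    using ab(3) unfolding 0(3,4) by (rule exchange_raiseD)
  have "t' \<rightleftharpoons> a0 @ [f1, e1] @ b0" unfolding 0(1) by (rule swap_eq_swap[OF 1(3)])
  from swap_eq_trans[OF t'(2) this] show ?case using ab(2) 0 1 by (intro exI conjI) auto
qed auto

lemma reduced_raise:
  assumes "reduced s"
  shows "reduced (raise k s)"
  unfolding reduced_def
proof (intro notI, elim exE)
  fix a e b assume "raise k s \<rightleftharpoons> a @ [e, flip_move e] @ b"
  from swap_eq_raiseD[OF this] obtain t where
    t: "a @ [e, flip_move e] @ b = raise k t" "s \<rightleftharpoons> t" by blast
  from map_eq_append_pair[OF t(1)[symmetric]] obtain a0 x y b0 where
    "t = a0 @ [x, y] @ b0" "e = raise_move k x" "flip_move e = raise_move k y" by blast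
  then show False using t(2) assms unfolding reduced_def
    by (metis raise_flip_move inj_raise_move)
qed

lemma normal_form_raise: "normal_form (raise k s) \<rightleftharpoons> raise k (normal_form s)"
  using normal_form_cong[OF equal_raise[OF equal_normal_form], of k s] normal_form_reduced[OF reduced_raise[OF reduced_normal_form]]
  by simp

lemma length_normal_form_raise: "length (normal_form (raise k s)) = length (normal_form s)"
  using swap_eq_length[OF normal_form_raise] by simp

section \<open>Moves at position 0\<close>

text \<open>
Moves at position 0 stay there under all exchanges and never pass each other. A move can pass
\<open>(0, l, d)\<close> only if it is clear of the first \<open>len l (\<not> d)\<close> letters afterwards, equivalently of the
first \<open>len l d\<close> letters before.
\<close>
lemma exchange_left:
  assumes "exchange (0, l, d) f f' e'"
  obtains g where "f = raise_move (len l (\<not> d)) g" "f' = raise_move (len l d) g" "e' = (0, l, d)"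
proof -
  obtain j m c where f: "f = (j, m, c)" by (cases f)
  let ?g = "(j - len l (\<not> d), m, c)"
  have "f = raise_move (len l (\<not> d)) ?g" "f' = raise_move (len l d) ?g" "e' = (0, l, d)"
    using assms len_pos[of m c] by (cases f'; cases e'; auto simp: f)+
  then show ?thesis by (rule that)
qed

lemma exchange_left':
  assumes "exchange e (0, l, d) f' e'"
  obtains g where "e = raise_move (len l d) g" "e' = raise_move (len l (\<not> d)) g" "f' = (0, l, d)"
proof -
  have "exchange (0, l, \<not> d) (flip_move e) (flip_move e') (flip_move f')"
    using swap_flip[OF assms] by simp
  then obtain g where g: "flip_move e = raise_move (len l d) g"
      "flip_move e' = raise_move (len l (\<not> d)) g" "flip_move f' = (0, l, \<not> d)"
    by (rule exchange_left) simp
  from g[THEN arg_cong[where f = flip_move]] show ?thesis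
    by (intro that[of "flip_move g"]) (auto simp: raise_flip_move)
qed

lemma exchange_nonleft:
  assumes "exchange e f f' e'"
  shows "fst f' = 0 \<longleftrightarrow> fst f = 0" "fst e' = 0 \<longleftrightarrow> fst e = 0"
proof -
  obtain i l d where e: "e = (i, l, d)" by (cases e)
  obtain j m c where f: "f = (j, m, c)" by (cases f)
  have "0 < len l d" "0 < len l (\<not> d)" "0 < len m c" "0 < len m (\<not> c)"
    by (rule len_pos)+
  with assms show "fst f' = 0 \<longleftrightarrow> fst f = 0" "fst e' = 0 \<longleftrightarrow> fst e = 0"
    by (cases f'; cases e'; auto simp: e f)+
qed

lemma lefts_swap_step:
  assumes "swap_step s t"
  shows "lefts t = lefts s"
proof -
  obtain a b e f f' e' where st: "s = a @ [e, f] @ b" "t = a @ [f', e'] @ b"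
    and ex: "exchange e f f' e'"
    using assms unfolding swap_step_def by blast
  show ?thesis by (simp add: st lefts_def exchange_nonleft[OF ex])
qed

lemma slide:
  "[(0, l, d)] @ raise (len l (\<not> d)) g \<asymp> raise (len l d) g @ [(0, l, d)]"
proof (induction g)
  case (Cons e g)
  obtain i m c where e: "e = (i, m, c)" by (cases e)
  let ?a = "raise_move (len l (\<not> d)) e" and ?b = "raise_move (len l d) e"
  have "exchange (0, l, d) ?a ?b (0, l, d)" by (simp add: e)
  from swap_eq_equal[OF swap_eq_swap[OF this, of "[]" "raise (len l (\<not> d)) g"]]
  have "[(0, l, d)] @ raise (len l (\<not> d)) (e # g) \<asymp> [?b] @ ([(0, l, d)] @ raise (len l (\<not> d)) g) @ []"
    by simp
  also have "\<dots> \<asymp> [?b] @ (raise (len l d) g @ [(0, l, d)]) @ []"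
    by (rule equal_context[OF Cons])
  finally show ?case by simp
qed simp

text \<open>
A move at position 0 and its reverse, separated only by a word \<open>b\<close> whose effect is clear of both,
so that they can be brought together and cancelled. The condition on \<open>b\<close> is membership in the subgroup of words
raised by \<open>len l (\<not> d)\<close>, so it only depends on the element represented by \<open>b\<close>.
\<close>
definition pinched :: "'l move list \<Rightarrow> bool" where
  "pinched s \<longleftrightarrow> (\<exists>a l d b c g. s = a @ (0, l, d) # b @ (0, l, \<not> d) # c \<and>
     lefts b = 0 \<and> b \<asymp> raise (len l (\<not> d)) g)"

lemma pinchedI:
  "b \<asymp> raise (len l (\<not> d)) g \<Longrightarrow> lefts b = 0 \<Longrightarrow> s = a @ (0, l, d) # b @ (0, l, \<not> d) # c \<Longrightarrow>
    pinched s"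
  unfolding pinched_def by blast

text \<open>
The first of the two moves slides over \<open>b\<close> and cancels. A shortest word for \<open>b\<close> which is raised
exists and is no longer than \<open>b\<close>, because normal forms commute with \<open>raise\<close>.
\<close>
lemma pinched_shorten:
  assumes "pinched s"
  obtains u where "s \<asymp> u" "length u < length s"
proof -
  obtain a l d b c g where s: "s = a @ (0, l, d) # b @ (0, l, \<not> d) # c"
    and g: "b \<asymp> raise (len l (\<not> d)) g"
    using assms unfolding pinched_def by blast
  let ?u = "a @ raise (len l d) (normal_form g) @ c"
  have "b \<asymp> raise (len l (\<not> d)) (normal_form g)"
    using g equal_raise[OF equal_normal_form] equal_trans by blast
  from equal_context[OF this, of "a @ [(0, l, d)]" "(0, l, \<not> d) # c"]
  have "s \<asymp> a @ ([(0, l, d)] @ raise (len l (\<not> d)) (normal_form g)) @ (0, l, \<not> d) # c"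
    by (simp add: s)
  also have "\<dots> \<asymp> a @ (raise (len l d) (normal_form g) @ [(0, l, d)]) @ (0, l, \<not> d) # c"
    by (rule equal_context[OF slide])
  also have "\<dots> = (a @ raise (len l d) (normal_form g)) @ [(0, l, d), flip_move (0, l, d)] @ c" by simp
  also have "\<dots> \<asymp> (a @ raise (len l d) (normal_form g)) @ c" by (rule equal_cancel)
  finally have "s \<asymp> ?u" by simp
  moreover have "length (normal_form g) \<le> length b"
    using length_normal_form_le[OF equal_sym[OF g]] by (simp add: length_normal_form_raise)
  then have "length ?u < length s" by (simp add: s)
  ultimately show ?thesis by (rule that)
qed

lemma append_pair_eq_append_Cons:
  "x @ [e, f] @ y = a @ z # b \<Longrightarrow>
     (\<exists>w. x = a @ z # w \<and> b = w @ [e, f] @ y) \<or> (x = a \<and> e = z \<and> b = f # y) \<or>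
     (a = x @ [e] \<and> f = z \<and> b = y) \<or> (\<exists>w. a = x @ [e, f] @ w \<and> y = w @ z # b)"
  by (auto simp: append_eq_append_conv2 append_eq_Cons_conv Cons_eq_append_conv)

text \<open>
An exchange involving one of the two moves at position 0 moves a letter into or out of \<open>b\<close>, and by
\<open>exchange_left\<close> this letter is raised sufficiently. An exchange inside \<open>b\<close> does not change the element.
\<close>
lemma pinched_exchange:
  assumes pinched: "pinched (x @ [e, f] @ y)" and ex: "exchange e f f' e'"
  shows "pinched (x @ [f', e'] @ y)"
proof -
  obtain a l d b c g where s: "x @ [e, f] @ y = a @ (0, l, d) # b @ (0, l, \<not> d) # c"
    and b: "lefts b = 0" and g: "b \<asymp> raise (len l (\<not> d)) g"
    using pinched unfolding pinched_def by blast
  let ?r = "raise_move (len l (\<not> d))"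
  from append_pair_eq_append_Cons[OF s] show ?thesis
  proof (elim disjE exE conjE)
    fix w assume x: "x = a @ (0, l, d) # w" and "b @ (0, l, \<not> d) # c = w @ [e, f] @ y"
    from append_pair_eq_append_Cons[OF this(2)[symmetric]] show ?thesis
    proof (elim disjE exE conjE)
      fix v assume "w = b @ (0, l, \<not> d) # v" "c = v @ [e, f] @ y"
      then show ?thesis using pinchedI[OF g b] x by simp
    next
      assume *: "w = b" "e = (0, l, \<not> d)" "c = f # y"
      obtain h where h: "f = raise_move (len l d) h" "f' = ?r h" "e' = e"
        using exchange_left[OF ex[unfolded *(2)]] *(2) by auto
      have "b @ [f'] \<asymp> raise (len l (\<not> d)) (g @ [h])"
        using equal_append[OF g, of "[f']" "[f']"] h(2) by simp
      moreover have "lefts (b @ [f']) = 0" using b h(2) len_pos[of l "\<not> d"] by (simp add: lefts_def)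
      ultimately show ?thesis
        by (rule pinchedI) (use * x h(3) in simp)
    next
      assume *: "b = w @ [e]" "f = (0, l, \<not> d)" "c = y"
      obtain h where h: "e = ?r h" "e' = raise_move (len l d) h" "f' = f"
        using exchange_left'[OF ex[unfolded *(2)]] *(2) by auto
      have "w \<asymp> raise (len l (\<not> d)) g @ inverse_word [e]"
        using g equal_move_right unfolding *(1) by blast
      then have "w \<asymp> raise (len l (\<not> d)) (g @ [flip_move h])"
        by (simp add: inverse_word_def h(1) raise_flip_move)
      moreover have "lefts w = 0" using b *(1) by simp
      ultimately show ?thesis
        by (rule pinchedI) (use * x h(3) in simp)
    next
      fix v assume *: "b = w @ [e, f] @ v" "y = v @ (0, l, \<not> d) # c"
      have "w @ [f', e'] @ v \<asymp> b"
        unfolding *(1) by (rule swap_eq_equal[OF swap_eq_swap[OF swap_sym[OF ex]]])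
      then have "w @ [f', e'] @ v \<asymp> raise (len l (\<not> d)) g" using g equal_trans by blast
      moreover have "lefts (w @ [f', e'] @ v) = 0"
        using b exchange_nonleft[OF ex] unfolding *(1) by (simp add: lefts_def split: if_splits)
      ultimately show ?thesis
        by (rule pinchedI) (use * x in simp)
    qed
  next
    assume *: "x = a" "e = (0, l, d)" and bc: "b @ (0, l, \<not> d) # c = f # y"
    obtain h where h: "f = ?r h" "f' = raise_move (len l d) h" "e' = e"
      using exchange_left[OF ex[unfolded *(2)]] *(2) by auto
    have "fst f \<noteq> 0" using h(1) len_pos[of l "\<not> d"] by simp
    then obtain b0 where b0: "b = f # b0" "y = b0 @ (0, l, \<not> d) # c"
      using bc by (cases b) auto
    have "[f] @ b0 \<asymp> raise (len l (\<not> d)) g" using g b0(1) by simp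
    from equal_move_left[OF this] have "b0 \<asymp> raise (len l (\<not> d)) (flip_move h # g)"
      by (simp add: inverse_word_def h(1) raise_flip_move)
    moreover have "lefts b0 = 0" using b b0(1) by (simp add: lefts_def split: if_splits)
    ultimately show ?thesis
      by (rule pinchedI[where a = "a @ [f']" and c = c]) (use * h(3) b0 in simp)
  next
    assume *: "a = x @ [e]" "f = (0, l, d)" and y: "b @ (0, l, \<not> d) # c = y"
    obtain h where h: "e = raise_move (len l d) h" "e' = ?r h" "f' = f"
      using exchange_left'[OF ex[unfolded *(2)]] *(2) by auto
    have "e' # b \<asymp> raise (len l (\<not> d)) (h # g)"
      using equal_append[OF _ g, of "[e']" "[e']"] h(2) by simp
    moreover have "lefts (e' # b) = 0" using b h(2) len_pos[of l "\<not> d"] by (simp add: lefts_def)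
    ultimately show ?thesis
      by (rule pinchedI[where a = x and c = c]) (use * h(3) y in simp)
  next
    fix w assume "a = x @ [e, f] @ w" "y = w @ (0, l, d) # b @ (0, l, \<not> d) # c"
    then show ?thesis using pinchedI[OF g b, of _ "x @ [f', e'] @ w" c] by simp
  qed
qed

lemma pinched_left_cancel:
  assumes "fst e = 0"
  shows "pinched (x @ [e, flip_move e] @ y)"
proof -
  obtain l d where "e = (0, l, d)" using assms by (cases e) auto
  then show ?thesis using pinchedI[of "[]" l d "[]" _ x y] by (simp add: lefts_def)
qed

text \<open>
Inserting a cancelling pair at position 0 creates a pinch; inserting one elsewhere keeps any pinch.
\<close>
lemma pinched_cancels:
  assumes "pinched (x @ y)"
  shows "pinched (x @ [e, flip_move e] @ y)"
proof (cases "fst e = 0")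
  case True
  then show ?thesis by (rule pinched_left_cancel)
next
  case False
  obtain a l d b c g where s: "x @ y = a @ (0, l, d) # b @ (0, l, \<not> d) # c"
    and b: "lefts b = 0" and g: "b \<asymp> raise (len l (\<not> d)) g"
    using assms unfolding pinched_def by blast
  from s consider w where "a = x @ w" "y = w @ (0, l, d) # b @ (0, l, \<not> d) # c"
    | w where "x = a @ (0, l, d) # w" "b @ (0, l, \<not> d) # c = w @ y"
    by (auto simp: append_eq_append_conv2 append_eq_Cons_conv Cons_eq_append_conv)
  then show ?thesis
  proof cases
    case 1
    then show ?thesis using pinchedI[OF g b, of _ "x @ [e, flip_move e] @ w" c] by simp
  next
    case (2 w)
    from 2(2) consider v where "b = w @ v" "y = v @ (0, l, \<not> d) # c"
      | v where "w = b @ (0, l, \<not> d) # v" "c = v @ y"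
      by (auto simp: append_eq_append_conv2 append_eq_Cons_conv Cons_eq_append_conv)
    then show ?thesis
    proof cases
      case (1 v)
      have "w @ [e, flip_move e] @ v \<asymp> raise (len l (\<not> d)) g"
        using equal_cancel[of w e v] g equal_trans unfolding 1(1) by blast
      moreover have "lefts (w @ [e, flip_move e] @ v) = 0" using b 1(1) False by (simp add: lefts_def)
      ultimately show ?thesis
        by (rule pinchedI[where a = a and c = c]) (use 1 2 in simp)
    next
      case (2 v)
      then show ?thesis
        using pinchedI[OF g b, of _ a "v @ [e, flip_move e] @ y"] \<open>x = _\<close> by simp
    qed
  qed
qed

lemma pinched_reduction_step: "reduction_step s t \<Longrightarrow> pinched t \<Longrightarrow> pinched s"
  unfolding reduction_step_def swap_step_def
  using pinched_exchange swap_sym pinched_cancels by (auto elim!: cancels.cases)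

lemma lefts_reduction_step:
  assumes "reduction_step s t" "\<not> pinched s"
  shows "lefts t = lefts s"
proof (cases "swap_step s t")
  case False
  then obtain a e b where st: "s = a @ [e, flip_move e] @ b" "t = a @ b"
    using assms(1) by (auto simp: reduction_step_def elim: cancels.cases)
  have "fst e \<noteq> 0" using assms(2) st(1) pinched_left_cancel by blast
  then show ?thesis by (simp add: st lefts_def)
qed (simp add: lefts_swap_step)

text \<open>
A reduction that eventually cancels two moves at position 0 must start from a pinched word, since
being pinched is inherited backwards. So without a pinch all moves at position 0 survive.
\<close>
lemma lefts_reduces:
  "reduces s t \<Longrightarrow> \<not> pinched s \<Longrightarrow> \<not> pinched t \<and> lefts t = lefts s"
  by (induction rule: rtranclp_induct) (auto dest: lefts_reduction_step pinched_reduction_step)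

lemma lefts_le_length:
  assumes "\<not> pinched s" "s \<asymp> t"
  shows "lefts s \<le> length t"
proof -
  have "lefts s = lefts (normal_form s)" using lefts_reduces[OF reduces_normal_form assms(1)] by simp
  also have "\<dots> \<le> length (normal_form s)" by (simp add: lefts_def)
  also have "\<dots> \<le> length t" by (rule length_normal_form_le[OF assms(2)])
  finally show ?thesis .
qed

text \<open>
A pinch inside one period shortens the word itself. A pinch across the boundary of two periods becomes
a pinch inside one period after conjugation by \<open>z\<close>. It cannot use \<open>z\<close> twice, as \<open>z\<close> is not its own
reverse.
\<close>
lemma pinched_power_word_shorten:
  assumes "pinched (power_word n (z # s))" "fst z = 0"
  obtains a u where "z # s \<asymp> a @ u @ inverse_word a" "length u < length (z # s)"
proof -
  obtain a l d b c g where s: "power_word n (z # s) = a @ (0, l, d) # b @ (0, l, \<not> d) # c"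
    and b: "lefts b = 0" and g: "b \<asymp> raise (len l (\<not> d)) g"
    using assms unfolding pinched_def by blast
  have "\<forall>e\<in>set b. fst e \<noteq> 0" using b by (simp add: lefts_def filter_empty_conv)
  from pair_in_power_word[OF s, of "\<lambda>e. fst e = 0", OF assms(2) this] show ?thesis
  proof (elim disjE exE conjE)
    fix a c assume "z # s = a @ (0, l, d) # b @ (0, l, \<not> d) # c"
    then have "pinched (z # s)" by (rule pinchedI[OF g b])
    then obtain u where "z # s \<asymp> u" "length u < length (z # s)" by (rule pinched_shorten)
    then show ?thesis using that[of "[]" u] by (simp add: inverse_word_def)
  next
    fix a assume *: "z # s = a @ (0, l, d) # b" "(0, l, \<not> d) = z"
    then obtain a0 where a: "a = z # a0" by (cases a) auto
    let ?t = "a0 @ (0, l, d) # b @ (0, l, \<not> d) # []"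
    have "pinched ?t" by (rule pinchedI[OF g b HOL.refl])
    then obtain u where u: "?t \<asymp> u" "length u < length ?t" by (rule pinched_shorten)
    have "z # s \<asymp> [z] @ ?t @ inverse_word [z]"
      using equal_sym[OF equal_cancel[of "z # s" z "[]"]] *(2)[symmetric] a *(1)
      by (simp add: inverse_word_def)
    also have "\<dots> \<asymp> [z] @ u @ inverse_word [z]" by (rule equal_context[OF u(1)])
    finally show ?thesis by (rule that) (use u(2) *(1) a in simp)
  qed
qed

lemma power_word_raise: "power_word n (raise k s) = raise k (power_word n s)"
  by (induction n) auto

lemma grows_raise: 
  assumes "grows s"
  shows "grows (raise k s)"
proof -
  obtain c where c: "\<And>n t. power_word n s \<asymp> t \<Longrightarrow> n \<le> length t + c"
    using assms unfolding grows_def by blast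
  have "n \<le> length t + c" if "power_word n (raise k s) \<asymp> t" for n t
  proof -
    have "n \<le> length (normal_form (power_word n s)) + c" by (rule c[OF equal_normal_form])
    also have "length (normal_form (power_word n s)) \<le> length t"
      using length_normal_form_le[OF that] by (simp add: power_word_raise length_normal_form_raise)
    finally show ?thesis by simp
  qed
  then show ?thesis unfolding grows_def by blast
qed

lemma lefts_power_word: "lefts (power_word n s) = n * lefts s"
  by (induction n) (auto simp: lefts_def)

lemma conjugate_not_Nil:
  assumes "s \<asymp> a @ u @ inverse_word a" "\<not> s \<asymp> []"
  shows "\<not> u \<asymp> []"
proof
  assume "u \<asymp> []"
  note assms(1)
  also have "a @ u @ inverse_word a \<asymp> a @ [] @ inverse_word a"
    by (rule equal_context[OF \<open>u \<asymp> []\<close>])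
  also have "\<dots> \<asymp> []" using equal_inverse_right[of a] by simp
  finally show False using assms(2) by blast
qed

lemma sum_list_fst_raise: "sum_list (map fst (raise k s)) = sum_list (map fst s) + k * length s"
  by (induction s) auto

text \<open>
The induction is lexicographic: first on the length, which drops when a shorter conjugate is found,
then on the sum of all positions, which drops when the whole word is lowered by 1.
\<close>
theorem nontrivial_grows: "\<not> s \<asymp> [] \<Longrightarrow> grows s"
proof (induction s rule: wf_induct_rule[OF wf_measures[of "[length, \<lambda>s. sum_list (map fst s)]"]])
  case (1 s)
  show ?case
  proof (cases "\<exists>e\<in>set s. fst e = 0")
    case False
    let ?t = "map (\<lambda>e. (fst e - 1, snd e)) s"
    have s: "s = raise 1 ?t"
      using False by (auto intro!: map_idI[symmetric])
    have "sum_list (map fst s) = sum_list (map fst ?t) + length s"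
      using sum_list_fst_raise[of 1 ?t] unfolding s[symmetric] by simp
    moreover have "s \<noteq> []" using 1(2) by auto
    ultimately have "(?t, s) \<in> measures [length, \<lambda>s. sum_list (map fst s)]" by simp
    moreover have "\<not> ?t \<asymp> []" using 1(2) equal_raise[of ?t "[]" 1] s by auto
    ultimately have "grows ?t" by (rule 1(1))
    from grows_raise[OF this, of 1] s show ?thesis by simp
  next
    case True
    then obtain a z c where s: "s = a @ z # c" "fst z = 0" by (meson split_list)
    \<comment> \<open>Rotate the word to start with a move at position 0.\<close>
    let ?t = "z # c @ a"
    have "s \<asymp> a @ ?t @ inverse_word a"
      using equal_sym[OF equal_append[OF _ equal_inverse_right[of a], of s s]] s by simp
    note conj = this
    have len: "length ?t = length s" using s by simp
    have "grows ?t"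
    proof (cases "\<exists>n. pinched (power_word n ?t)")
      case True
      then obtain n where "pinched (power_word n ?t)" by blast
      then obtain b u where u: "?t \<asymp> b @ u @ inverse_word b" "length u < length ?t"
        using s(2) by (rule pinched_power_word_shorten)
      have "\<not> u \<asymp> []" using conjugate_not_Nil[OF u(1)] conjugate_not_Nil[OF conj 1(2)] by blast
      with u(2) len have "grows u" by (intro 1(1)) auto
      then show ?thesis by (rule grows_conjugate[OF _ u(1)])
    next
      case False
      have "n \<le> length t + 0" if "power_word n ?t \<asymp> t" for n t
      proof -
        have "n \<le> n * lefts ?t" using s(2) by (simp add: lefts_def)
        also have "\<dots> \<le> length t"
          using lefts_le_length[OF _ that] False unfolding lefts_power_word by blast
        finally show ?thesis by simp
      qed
      then show ?thesis unfolding grows_def by blast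
    qed
    then show ?thesis by (rule grows_conjugate[OF _ conj])
  qed
qed

corollary length_power_word_ge:
  "\<not> s \<asymp> [] \<Longrightarrow> power_word n s \<asymp> t \<Longrightarrow> n \<le> length t"
  using nontrivial_grows grows_imp_length_ge by blast

end

section \<open>Edge paths as words of moves\<close>

text \<open>
The maximum gives positive lengths also to pairs with an empty side, which never occur as relations.
\<close>
definition side_length :: "'a list \<times> 'a list \<Rightarrow> bool \<Rightarrow> nat" where
  "side_length r d = max 1 (length (if d then fst r else snd r))"

interpretation squier: interval_moves side_length
  by unfold_locales (simp add: side_length_def)

notation squier.equal_words (infix "\<asymp>" 50)

fun edge_move :: "('a list \<times> 'a list) set \<Rightarrow> 'a edge \<Rightarrow> ('a list \<times> 'a list) move" where
  "edge_move R (Edge p u v q) =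
     (length p, if (u, v) \<in> R then ((u, v), True) else ((v, u), False))"

abbreviation word_of :: "('a list \<times> 'a list) set \<Rightarrow> 'a edge list \<Rightarrow> ('a list \<times> 'a list) move list" where
  "word_of R \<equiv> map (edge_move R)"

locale presentation =
  fixes S :: "'a set" and R :: "('a list \<times> 'a list) set"
  assumes pres: "semigroup_presentation S R"
begin

lemma relation_words:
  assumes "(u, v) \<in> R \<or> (v, u) \<in> R"
  shows "u \<noteq> []" "v \<noteq> []" "u \<in> lists S" "v \<in> lists S"
  using assms pres unfolding semigroup_presentation_def nonempty_words_def by blast+

lemma relation_antisym: "(u, v) \<in> R \<Longrightarrow> (v, u) \<notin> R"
  using pres unfolding semigroup_presentation_def by blast

lemma Edge_in_edges:
  "Edge p u v q \<in> edges S R \<longleftrightarrow> p \<in> lists S \<and> q \<in> lists S \<and> ((u, v) \<in> R \<or> (v, u) \<in> R)"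
  by (auto simp: edges_def)

lemma edge_move_cases:
  assumes "(u, v) \<in> R \<or> (v, u) \<in> R"
  obtains r d where "\<And>p q. edge_move R (Edge p u v q) = (length p, r, d)"
    "\<And>p q. edge_move R (Edge p v u q) = (length p, r, \<not> d)"
    "side_length r d = length u" "side_length r (\<not> d) = length v"
proof (cases "(u, v) \<in> R")
  case True
  then show ?thesis
    using that[of "(u, v)" True] relation_antisym[OF True] relation_words[OF assms]
    by (auto simp: side_length_def Suc_le_eq max_def not_le)
next
  case False
  then show ?thesis
    using that[of "(v, u)" False] assms relation_words[OF assms]
    by (auto simp: side_length_def Suc_le_eq max_def not_le)
qed

lemma edge_move_inverse: "e \<in> edges S R \<Longrightarrow> edge_move R (inverse_edge e) = flip_move (edge_move R e)"
proof (cases e)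
  case (Edge p u v q)
  assume "e \<in> edges S R"
  then have "(u, v) \<in> R \<or> (v, u) \<in> R" by (simp add: Edge Edge_in_edges)
  then show ?thesis by (rule edge_move_cases[where u = u and v = v]) (simp add: Edge)
qed

lemma edge_move_eq_inverse:
  assumes "e \<in> edges S R" "f \<in> edges S R" "terminus e = origin f"
    "edge_move R f = flip_move (edge_move R e)"
  shows "f = inverse_edge e"
proof -
  obtain p u v q where e: "e = Edge p u v q" by (cases e)
  obtain p' u' v' q' where f: "f = Edge p' u' v' q'" by (cases f)
  have uv: "(u, v) \<in> R \<or> (v, u) \<in> R" "(u', v') \<in> R \<or> (v', u') \<in> R"
    using assms(1,2) by (simp_all add: e f Edge_in_edges)
  have "length p' = length p" "u' = v" "v' = u"
    using assms(4) uv by (auto simp: e f split: if_splits)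
  then show ?thesis using assms(3) by (simp add: e f)
qed

text \<open>
The two boundary paths of a square in the Squier complex, up to the parts of the words to the right
of the moves, which leave no trace in the moves.
\<close>
lemma edge_moves_exchange:
  assumes "(u1, v1) \<in> R \<or> (v1, u1) \<in> R" "(u2, v2) \<in> R \<or> (v2, u2) \<in> R"
  shows "squier.exchange (edge_move R (Edge p u1 v1 q1)) (edge_move R (Edge (p @ v1 @ z) u2 v2 q2))
    (edge_move R (Edge (p @ u1 @ z) u2 v2 q3)) (edge_move R (Edge p u1 v1 q4))"
proof -
  obtain r d where 1: "\<And>p q. edge_move R (Edge p u1 v1 q) = (length p, r, d)"
      "side_length r d = length u1" "side_length r (\<not> d) = length v1"
    using edge_move_cases[OF assms(1)] by metis
  obtain r' d' where "\<And>p q. edge_move R (Edge p u2 v2 q) = (length p, r', d')"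
    using edge_move_cases[OF assms(2)] by metis
  with 1 show ?thesis by (simp del: edge_move.simps)
qed

lemma is_path_edges: "is_path S R x s y \<Longrightarrow> set s \<subseteq> edges S R"
  by (induction s arbitrary: x) auto

lemma homotopic_words: "homotopic S R x y s t \<Longrightarrow> word_of R s \<asymp> word_of R t"
proof (induction rule: homotopic.induct)
  case (refl s)
  then show ?case by simp
next
  case (sym s t)
  from sym.IH show ?case by (rule squier.equal_sym)
next
  case (trans s t r)
  from trans.IH show ?case by (rule squier.equal_trans)
next
  case (cancel s e t)
  then have "e \<in> edges S R" using is_path_edges by fastforce
  then show ?case
    using squier.equal_cancel[of "word_of R s" "edge_move R e"] by (simp add: edge_move_inverse)
next
  case (cell p1 p2 s t)
  from cell(1) obtain p z q l1 r1 l2 r2 where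
    eq: "p1 = [Edge p l1 r1 (z @ l2 @ q), Edge (p @ r1 @ z) l2 r2 q]"
      "p2 = [Edge (p @ l1 @ z) l2 r2 q, Edge p l1 r1 (z @ r2 @ q)]"
    and R: "(l1, r1) \<in> R" "(l2, r2) \<in> R"
    unfolding squier_cells_def by blast
  have "squier.exchange (edge_move R (Edge p l1 r1 (z @ l2 @ q))) (edge_move R (Edge (p @ r1 @ z) l2 r2 q))
    (edge_move R (Edge (p @ l1 @ z) l2 r2 q)) (edge_move R (Edge p l1 r1 (z @ r2 @ q)))"
    by (rule edge_moves_exchange) (use R in auto)
  from squier.swap_eq_equal[OF squier.swap_eq_swap[OF this, of "word_of R s" "word_of R t"]]
  show ?case by (simp add: eq del: edge_move.simps)
qed

section \<open>Lifting exchanges and cancellations to homotopies\<close>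

text \<open>
A square may be read from another corner: insert \<open>f1\<close> and its inverse behind \<open>e1 e2\<close>, use the given
homotopy in the middle, and cancel \<open>e1\<close>.
\<close>
lemma homotopic_turn:
  assumes "homotopic S R x y [inverse_edge e1, f2] [e2, inverse_edge f1]"
  shows "homotopic S R (origin e1) (origin (inverse_edge f1)) [e1, e2] [f2, f1]"
proof -
  have e: "e1 \<in> edges S R" "e2 \<in> edges S R" "f1 \<in> edges S R" "f2 \<in> edges S R"
    and x: "x = terminus e1" "x = origin e2" "origin e1 = origin f2" 
    and y: "y = terminus f2" "y = origin f1" "terminus e2 = terminus f1"
    using homotopic_is_path[OF pres assms] by (auto simp: origin_nonempty_word[OF pres])
  let ?a = "origin e1" and ?b = "origin (inverse_edge f1)"
  have p1: "is_path S R ?a [e1] x" and p2: "is_path S R y [f1] ?b"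
    using e x y by (auto simp: origin_nonempty_word[OF pres])
  have "is_path S R ?a ([e1, e2] @ [inverse_edge f1, inverse_edge (inverse_edge f1)] @ []) ?b"
    using e x y by (auto simp: origin_nonempty_word[OF pres])
  from homotopic.sym[OF homotopic.cancel[OF this]]
  have 1: "homotopic S R ?a ?b [e1, e2] [e1, e2, inverse_edge f1, f1]" by simp
  have 2: "homotopic S R ?a ?b [e1, e2, inverse_edge f1, f1] [e1, inverse_edge e1, f2, f1]"
    using homotopic_append[OF pres homotopic.sym[OF assms] p1 p2] by simp
  have "is_path S R ?a ([] @ [e1, inverse_edge e1] @ [f2, f1]) ?b"
    using e x y by (auto simp: origin_nonempty_word[OF pres])
  from homotopic.cancel[OF this]
  have 3: "homotopic S R ?a ?b [e1, inverse_edge e1, f2, f1] [f2, f1]" by simp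
  from homotopic.trans[OF 1 homotopic.trans[OF 2 3]] show ?thesis .
qed

lemma homotopic_cell:
  assumes "(u1, v1) \<in> R" "(u2, v2) \<in> R" "p \<in> lists S" "z \<in> lists S" "q \<in> lists S"
  shows "homotopic S R (p @ u1 @ z @ u2 @ q) (p @ v1 @ z @ v2 @ q)
    [Edge p u1 v1 (z @ u2 @ q), Edge (p @ v1 @ z) u2 v2 q]
    [Edge (p @ u1 @ z) u2 v2 q, Edge p u1 v1 (z @ v2 @ q)]"
proof -
  let ?e = "[Edge p u1 v1 (z @ u2 @ q), Edge (p @ v1 @ z) u2 v2 q]"
  let ?f = "[Edge (p @ u1 @ z) u2 v2 q, Edge p u1 v1 (z @ v2 @ q)]"
  have "(?e, ?f) \<in> squier_cells S R" using assms unfolding squier_cells_def by blast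
  moreover have "is_path S R (p @ u1 @ z @ u2 @ q) ([] @ ?e @ []) (p @ v1 @ z @ v2 @ q)"
    using assms relation_words[of u1 v1] relation_words[of u2 v2]
    by (simp add: Edge_in_edges nonempty_words_def)
  ultimately show ?thesis using homotopic.cell[of ?e ?f S R _ "[]" "[]"] by simp
qed

text \<open>
The 2-cells are attached only for relations read from left to right. Turning a cell once or twice
gives the other three choices of directions.
\<close>
lemma homotopic_exchange:
  assumes "(u1, v1) \<in> R \<or> (v1, u1) \<in> R" "(u2, v2) \<in> R \<or> (v2, u2) \<in> R"
    and lists: "p \<in> lists S" "z \<in> lists S" "q \<in> lists S"
  shows "homotopic S R (p @ u1 @ z @ u2 @ q) (p @ v1 @ z @ v2 @ q)
    [Edge p u1 v1 (z @ u2 @ q), Edge (p @ v1 @ z) u2 v2 q]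
    [Edge (p @ u1 @ z) u2 v2 q, Edge p u1 v1 (z @ v2 @ q)]"
proof -
  have forward: "homotopic S R (p @ u1 @ z @ u2 @ q) (p @ v1 @ z @ v2 @ q)
    [Edge p u1 v1 (z @ u2 @ q), Edge (p @ v1 @ z) u2 v2 q]
    [Edge (p @ u1 @ z) u2 v2 q, Edge p u1 v1 (z @ v2 @ q)]"
    if "(u1, v1) \<in> R" "(u2, v2) \<in> R \<or> (v2, u2) \<in> R" for u1 v1
    using that(2)
  proof
    assume "(u2, v2) \<in> R"
    with that(1) show ?thesis by (rule homotopic_cell[OF _ _ lists])
  next
    assume "(v2, u2) \<in> R"
    from homotopic.sym[OF homotopic_cell[OF that(1) this lists]]
    have "homotopic S R (p @ u1 @ z @ v2 @ q) (p @ v1 @ z @ u2 @ q)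
      [inverse_edge (Edge (p @ u1 @ z) u2 v2 q), Edge p u1 v1 (z @ u2 @ q)]
      [Edge p u1 v1 (z @ v2 @ q), inverse_edge (Edge (p @ v1 @ z) u2 v2 q)]" by simp
    from homotopic.sym[OF homotopic_turn[OF this]] show ?thesis by simp
  qed
  show ?thesis
    using assms(1)
  proof
    assume "(u1, v1) \<in> R"
    then show ?thesis using forward assms(2) by blast
  next
    assume "(v1, u1) \<in> R"
    from forward[OF this assms(2)]
    have "homotopic S R (p @ v1 @ z @ u2 @ q) (p @ u1 @ z @ v2 @ q)
      [inverse_edge (Edge p u1 v1 (z @ u2 @ q)), Edge (p @ u1 @ z) u2 v2 q]
      [Edge (p @ v1 @ z) u2 v2 q, inverse_edge (Edge p u1 v1 (z @ v2 @ q))]" by simp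
    from homotopic_turn[OF this] show ?thesis by simp
  qed
qed

text \<open>
The position and the relation determine an edge once its origin is known, so the word that joins the
two edges recovers the letters between the two intervals.
\<close>
lemma lift_exchange:
  assumes path: "is_path S R x [e, f] y"
    and ex: "squier.exchange (edge_move R e) (edge_move R f) m n"
  obtains f' e' where "homotopic S R x y [e, f] [f', e']" "edge_move R f' = m" "edge_move R e' = n"
proof -
  obtain p1 u1 v1 q1 where e: "e = Edge p1 u1 v1 q1" by (cases e)
  obtain p2 u2 v2 q2 where f: "f = Edge p2 u2 v2 q2" by (cases f)
  have R: "(u1, v1) \<in> R \<or> (v1, u1) \<in> R" "(u2, v2) \<in> R \<or> (v2, u2) \<in> R"
    and lists: "p1 \<in> lists S" "q1 \<in> lists S" "p2 \<in> lists S" "q2 \<in> lists S"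
    and mid: "p1 @ v1 @ q1 = p2 @ u2 @ q2" and xy: "x = p1 @ u1 @ q1" "y = p2 @ v2 @ q2"
    using path by (auto simp: e f Edge_in_edges)
  obtain r d where 1: "edge_move R e = (length p1, r, d)" "side_length r (\<not> d) = length v1"
    using edge_move_cases[OF R(1)] e by metis
  obtain r' d' where 2: "edge_move R f = (length p2, r', d')" "side_length r' d' = length u2"
    using edge_move_cases[OF R(2)] f by metis
  have "length (p1 @ v1) \<le> length p2 \<or> length (p2 @ u2) \<le> length p1"
    using ex 1 2 by (cases m; cases n) auto
  then show ?thesis
  proof
    assume "length (p1 @ v1) \<le> length p2"
    with mid obtain z where z: "p2 = p1 @ v1 @ z" "q1 = z @ u2 @ q2"
      by (auto simp: append_eq_append_conv2) 
    let ?f' = "Edge (p1 @ u1 @ z) u2 v2 q2" and ?e' = "Edge p1 u1 v1 (z @ v2 @ q2)"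
    have "homotopic S R x y [e, f] [?f', ?e']"
      unfolding e f xy z using homotopic_exchange[OF R lists(1) _ lists(4), of z] lists(3) z by simp
    moreover have "squier.exchange (edge_move R e) (edge_move R f) (edge_move R ?f') (edge_move R ?e')"
      unfolding e f z by (rule edge_moves_exchange[OF R])
    ultimately show ?thesis using squier.swap_unique[OF ex] that by blast
  next
    assume "length (p2 @ u2) \<le> length p1"
    with mid[symmetric] obtain z where z: "p1 = p2 @ u2 @ z" "q2 = z @ v1 @ q1"
      by (auto simp: append_eq_append_conv2) 
    let ?f' = "Edge p2 u2 v2 (z @ u1 @ q1)" and ?e' = "Edge (p2 @ v2 @ z) u1 v1 q1"
    have "homotopic S R x y [e, f] [?f', ?e']"
      unfolding e f xy z
      using homotopic.sym[OF homotopic_exchange[OF R(2,1) lists(3) _ lists(2), of z]] lists(1) z by simp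
    moreover have "squier.exchange (edge_move R e) (edge_move R f) (edge_move R ?f') (edge_move R ?e')"
      unfolding e f z by (rule squier.swap_sym[OF edge_moves_exchange[OF R(2,1)]])
    ultimately show ?thesis using squier.swap_unique[OF ex] that by blast
  qed
qed

lemma lift_reduction_step:
  assumes path: "is_path S R x s y" and red: "squier.reduction_step (word_of R s) t"
  obtains s' where "homotopic S R x y s s'" "word_of R s' = t"
  using red unfolding squier.reduction_step_def
proof (elim disjE)
  assume "squier.swap_step (word_of R s) t"
  then obtain a b m1 m2 n2 n1 where ab: "word_of R s = a @ [m1, m2] @ b" "t = a @ [n2, n1] @ b"
    and ex: "squier.exchange m1 m2 n2 n1"
    unfolding squier.swap_step_def by blast
  from map_eq_append_pair[OF ab(1)] obtain s1 e f s2 where s: "s = s1 @ [e, f] @ s2"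
    and eq: "a = word_of R s1" "m1 = edge_move R e" "m2 = edge_move R f" "b = word_of R s2" by blast
  obtain i j where i: "is_path S R x s1 i" and j: "is_path S R i [e, f] j" and k: "is_path S R j s2 y"
    using path unfolding s is_path_append[OF pres] by blast
  from lift_exchange[OF j ex[unfolded eq]] obtain f' e' where
    "homotopic S R i j [e, f] [f', e']" and fe: "edge_move R f' = n2" "edge_move R e' = n1" by blast
  from homotopic_append[OF pres this(1) i k]
  have "homotopic S R x y s (s1 @ [f', e'] @ s2)" unfolding s .
  then show ?thesis by (rule that) (simp add: ab eq fe)
next
  assume "squier.cancels (word_of R s) t"
  then obtain a m b where ab: "word_of R s = a @ [m, flip_move m] @ b" "t = a @ b"
    by cases blast
  from map_eq_append_pair[OF ab(1)] obtain s1 e f s2 where s: "s = s1 @ [e, f] @ s2"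
    and eq: "a = word_of R s1" "m = edge_move R e" "flip_move m = edge_move R f" "b = word_of R s2"
    by blast
  have "e \<in> edges S R" "f \<in> edges S R" "terminus e = origin f"
    using path unfolding s is_path_append[OF pres] by auto
  then have f: "f = inverse_edge e" by (rule edge_move_eq_inverse) (use eq in simp)
  from homotopic.cancel[OF path[unfolded s f]] show ?thesis
    by (intro that[of "s1 @ s2"]) (simp_all add: s f ab eq)
qed

lemma lift_reduces:
  "squier.reduces (word_of R s) t \<Longrightarrow> is_path S R x s y \<Longrightarrow>
     \<exists>s'. homotopic S R x y s s' \<and> word_of R s' = t"
proof (induction rule: rtranclp_induct)
  case base
  then show ?case by (auto intro: homotopic.refl)
next
  case (step t u)
  then obtain s' where s': "homotopic S R x y s s'" "word_of R s' = t" by blast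
  from homotopic_is_path[OF pres s'(1)] have "is_path S R x s' y" by blast
  from lift_reduction_step[OF this] step.hyps(2) s'(2) obtain s'' where
    "homotopic S R x y s' s''" "word_of R s'' = u" by metis
  with s'(1) show ?case using homotopic.trans by fast
qed

lemma trivial_word_homotopic:
  assumes "is_path S R x s x" "word_of R s \<asymp> []"
  shows "homotopic S R x x s []"
  using lift_reduces[OF squier.equal_Nil_reduces[OF assms(2)] assms(1)] by auto

lemma homotopic_power_length:
  assumes "is_path S R x s x" "\<not> homotopic S R x x s []"
    and "homotopic S R x x (concat (replicate n s)) t"
  shows "n \<le> length t"
proof -
  have "\<not> word_of R s \<asymp> []" using assms trivial_word_homotopic by blast
  moreover have "squier.power_word n (word_of R s) \<asymp> word_of R t"
    using homotopic_words[OF assms(3)] by (simp add: squier.power_word_def map_concat)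
  ultimately have "n \<le> length (word_of R t)" by (rule squier.length_power_word_ge)
  then show ?thesis by simp
qed

end

section \<open>The length of a shortest loop\<close>

definition loop_length :: "'a edge list set \<Rightarrow> nat" where
  "loop_length P = (LEAST n. \<exists>s\<in>P. length s = n)"

locale pointed_presentation = presentation +
  fixes w :: "'a list"
  assumes w: "w \<in> nonempty_words S"
begin

abbreviation "D \<equiv> diagram_group S R w"
abbreviation "loop_class s \<equiv> loop_homotopy S R w `` {s}"

lemma loop_class_eq: "s \<in> loops S R w \<Longrightarrow> t \<in> loops S R w \<Longrightarrow>
    loop_class s = loop_class t \<longleftrightarrow> homotopic S R w w s t"
  using eq_equiv_class_iff[OF equiv_loop_homotopy[OF pres]] by (simp add: loop_homotopy_def)

lemma Nil_loop: "[] \<in> loops S R w"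
  using w by (simp add: loops_def)

lemma append_loop: "s \<in> loops S R w \<Longrightarrow> t \<in> loops S R w \<Longrightarrow> s @ t \<in> loops S R w"
  by (auto simp: loops_def is_path_append[OF pres])

lemma power_loop: "s \<in> loops S R w \<Longrightarrow> concat (replicate n s) \<in> loops S R w"
  by (induction n) (auto intro: Nil_loop append_loop)

lemma one_D: "\<one>\<^bsub>D\<^esub> = loop_class []"
  by (simp add: diagram_group_def)

lemma power_D: "s \<in> loops S R w \<Longrightarrow> loop_class s [^]\<^bsub>D\<^esub> (n::nat) = loop_class (concat (replicate n s))"
proof (induction n)
  case (Suc n)
  have "concat (replicate (Suc n) s) = concat (replicate n s) @ s"
    by (induction n) auto
  then show ?case using Suc power_loop diagram_group_mult[OF pres]
    by (simp add: Group.nat_pow_Suc)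
qed (simp add: one_D)

lemma shortest_loop:
  assumes "P \<in> carrier D"
  obtains s where "s \<in> loops S R w" "P = loop_class s" "length s = loop_length P"
proof -
  obtain s0 where s0: "s0 \<in> loops S R w" "P = loop_class s0"
    using assms by (auto simp: diagram_group_def quotient_def)
  have "s0 \<in> P" using s0 equiv_class_self[OF equiv_loop_homotopy[OF pres]] by blast
  then have "\<exists>n. \<exists>s\<in>P. length s = n" by blast
  from LeastI_ex[OF this] obtain s where s: "s \<in> P" "length s = loop_length P"
    unfolding loop_length_def by blast
  then have "homotopic S R w w s0 s" using s0 by (simp add: loop_homotopy_def)
  then have "s \<in> loops S R w" using homotopic_is_path[OF pres] by (auto simp: loops_def)
  then show ?thesis
    using that s s0 loop_class_eq \<open>homotopic S R w w s0 s\<close> by auto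
qed

lemma loop_length_le: "s \<in> loops S R w \<Longrightarrow> loop_length (loop_class s) \<le> length s"
  unfolding loop_length_def
  by (rule Least_le) (use equiv_class_self[OF equiv_loop_homotopy[OF pres]] in blast)

lemma group_D: "group D"
  by (rule group_diagram_group[OF pres w])

lemma mult_D: "s \<in> loops S R w \<Longrightarrow> t \<in> loops S R w \<Longrightarrow> loop_class s \<otimes>\<^bsub>D\<^esub> loop_class t = loop_class (s @ t)"
  by (rule diagram_group_mult[OF pres])

lemma loop_class_carrier: "s \<in> loops S R w \<Longrightarrow> loop_class s \<in> carrier D"
  by (simp add: diagram_group_def quotientI)

lemma inv_D:
  assumes s: "s \<in> loops S R w"
  shows "rev (map inverse_edge s) \<in> loops S R w"
    "inv\<^bsub>D\<^esub> (loop_class s) = loop_class (rev (map inverse_edge s))"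
proof -
  let ?t = "rev (map inverse_edge s)"
  show t: "?t \<in> loops S R w" using s inverse_path(1)[OF pres] by (simp add: loops_def)
  have "homotopic S R w w (?t @ s) []" using s inverse_path(2)[OF pres] by (simp add: loops_def)
  then have "loop_class ?t \<otimes>\<^bsub>D\<^esub> loop_class s = \<one>\<^bsub>D\<^esub>"
    using s t by (simp add: mult_D one_D loop_class_eq append_loop Nil_loop)
  then show "inv\<^bsub>D\<^esub> (loop_class s) = loop_class ?t"
    by (rule group.inv_equality[OF group_D]) (use s t in \<open>simp_all add: loop_class_carrier\<close>)
qed

lemma loop_length_one: "loop_length \<one>\<^bsub>D\<^esub> = 0"
  using loop_length_le[OF Nil_loop] by (simp add: one_D)

lemma loop_length_mult:
  assumes "P \<in> carrier D" "Q \<in> carrier D"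
  shows "loop_length (P \<otimes>\<^bsub>D\<^esub> Q) \<le> loop_length P + loop_length Q"
proof -
  obtain s where s: "s \<in> loops S R w" "P = loop_class s" "length s = loop_length P"
    using shortest_loop[OF assms(1)] .
  obtain t where t: "t \<in> loops S R w" "Q = loop_class t" "length t = loop_length Q"
    using shortest_loop[OF assms(2)] .
  show ?thesis using loop_length_le[OF append_loop[OF s(1) t(1)]] s t by (simp add: mult_D)
qed

lemma loop_length_inv:
  assumes "P \<in> carrier D"
  shows "loop_length (inv\<^bsub>D\<^esub> P) \<le> loop_length P"
proof -
  obtain s where s: "s \<in> loops S R w" "P = loop_class s" "length s = loop_length P"
    using shortest_loop[OF assms] .
  show ?thesis using loop_length_le[OF inv_D(1)[OF s(1)]] s by (simp add: inv_D(2))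
qed

lemma loop_length_power:
  assumes "P \<in> carrier D" "P \<noteq> \<one>\<^bsub>D\<^esub>"
  shows "n \<le> loop_length (P [^]\<^bsub>D\<^esub> (n::nat))"
proof -
  obtain s where s: "s \<in> loops S R w" "P = loop_class s"
    using shortest_loop[OF assms(1)] .
  let ?p = "concat (replicate n s)"
  have p: "?p \<in> loops S R w" by (rule power_loop[OF s(1)])
  obtain t where t: "t \<in> loops S R w" "loop_class ?p = loop_class t"
    "length t = loop_length (loop_class ?p)"
    using shortest_loop[OF loop_class_carrier[OF p]] .
  have "\<not> homotopic S R w w s []" using assms(2) s loop_class_eq Nil_loop one_D by metis
  moreover have "homotopic S R w w ?p t" using t p loop_class_eq by blast
  ultimately have "n \<le> length t" using s(1) homotopic_power_length by (simp add: loops_def)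
  then show ?thesis using t(3) s by (simp add: power_D)
qed

end

section \<open>Abelian groups with a length function\<close>

text \<open>
Dirichlet's theorem for the vector \<open>m / n\<close>, with denominators cleared.
\<close>
lemma simultaneous_approximation_int:
  fixes m :: "'x \<Rightarrow> int" and n N :: nat
  assumes "finite X" "0 < N" "0 < n"
  obtains q :: nat and p :: "'x \<Rightarrow> int" where "0 < q" "q \<le> N ^ card X"
    "\<And>x. x \<in> X \<Longrightarrow> int N * \<bar>int n * p x - int q * m x\<bar> \<le> int n"
proof -
  obtain f where f: "bij_betw f X {0..<card X}"
    using ex_bij_betw_finite_nat[OF assms(1)] by blast
  let ?x = "the_inv_into X f"
  obtain q p where q: "0 < q" "q \<le> int (N ^ card X)"
    and p: "\<And>i. i < card X \<Longrightarrow> \<bar>of_int q * (of_int (m (?x i)) / real n) - of_int (p i)\<bar> < 1 / N"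
    using Dirichlet_approx_simult[OF assms(2), of "card X" "\<lambda>i. of_int (m (?x i)) / real n"] by blast
  show ?thesis
  proof (rule that[of "nat q" "\<lambda>x. p (f x)"])
    show "0 < nat q" "nat q \<le> N ^ card X" using q by (auto simp: nat_le_iff)
  next
    fix x assume x: "x \<in> X"
    then have "f x < card X" "?x (f x) = x"
      using f by (auto simp: bij_betw_def the_inv_into_f_f)
    moreover define a where "a = of_int q * (of_int (m x) / real n) - of_int (p (f x))"
    ultimately have "\<bar>a\<bar> < 1 / N" using p[of "f x"] by simp
    then have "real N * \<bar>a\<bar> < 1" using assms(2) by (simp add: field_simps)
    then have "real n * (real N * \<bar>a\<bar>) < real n * 1"
      using assms(3) by (intro mult_strict_left_mono) auto
    moreover have "real n * (real N * \<bar>a\<bar>) = real N * \<bar>real n * a\<bar>"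
      by (simp add: abs_mult)
    moreover have "real n * a = of_int (q * m x - int n * p (f x))"
      using assms(3) by (simp add: a_def field_simps)
    ultimately have "of_int (int N * \<bar>q * m x - int n * p (f x)\<bar>) < (of_int (int n) :: real)"
      by (simp only: of_int_mult of_int_abs of_int_of_nat_eq mult_1_right)
    then show "int N * \<bar>int n * p (f x) - int (nat q) * m x\<bar> \<le> int n"
      using q(1) by (simp only: of_int_less_iff) (simp add: abs_minus_commute)
  qed
qed

text \<open>
Subadditivity and invariance under inverses are what bounds the length linearly by word length.
\<close>
locale group_length = group G for G (structure) +
  fixes len :: "'a \<Rightarrow> nat"
  assumes len_one: "len \<one> = 0"
    and len_mult: "x \<in> carrier G \<Longrightarrow> y \<in> carrier G \<Longrightarrow> len (x \<otimes> y) \<le> len x + len y"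
    and len_inv: "x \<in> carrier G \<Longrightarrow> len (inv x) \<le> len x"
begin

lemma len_nat_pow: "x \<in> carrier G \<Longrightarrow> len (x [^] (n::nat)) \<le> n * len x"
proof (induction n)
  case (Suc n)
  then show ?case using len_mult[of "x [^] n" x] by simp
qed (simp add: len_one)

lemma len_int_pow:
  assumes x: "x \<in> carrier G"
  shows "int (len (x [^] (k::int))) \<le> \<bar>k\<bar> * int (len x)"
proof (cases "0 \<le> k")
  case True
  then obtain n where "k = int n" by (metis nonneg_int_cases)
  then show ?thesis using len_nat_pow[OF x, of n]
    by (simp add: int_pow_int flip: of_nat_mult)
next
  case False
  then obtain n where k: "k = - int n" by (metis linear nonpos_int_cases)
  have "len (inv (x [^] n)) \<le> n * len x"
    using len_inv[of "x [^] n"] len_nat_pow[OF x, of n] x by simp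
  then show ?thesis
    by (simp add: k int_pow_neg_int x flip: of_nat_mult)
qed

lemma len_foldr:
  assumes "set xs \<subseteq> Z" "Z \<subseteq> carrier G" "\<And>z. z \<in> Z \<Longrightarrow> len z \<le> M"
  shows "len (foldr (\<otimes>) xs \<one>) \<le> M * length xs" and "foldr (\<otimes>) xs \<one> \<in> carrier G"
  using assms(1)
proof (induction xs)
  case (Cons x xs)
  { case 1
    then show ?case
      using Cons len_mult[of x "foldr (\<otimes>) xs \<one>"] assms(2) assms(3)[of x] by force }
  { case 2
    then show ?case using Cons assms(2) by auto }
qed (simp_all add: len_one)

end

lemma (in group) foldr_mult_append:
  "set xs \<subseteq> carrier G \<Longrightarrow> set ys \<subseteq> carrier G \<Longrightarrow>
     foldr (\<otimes>) (xs @ ys) \<one> = foldr (\<otimes>) xs \<one> \<otimes> foldr (\<otimes>) ys \<one> \<and> foldr (\<otimes>) xs \<one> \<in> carrier G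
     \<and> foldr (\<otimes>) ys \<one> \<in> carrier G"
proof -
  have closed: "set zs \<subseteq> carrier G \<Longrightarrow> foldr (\<otimes>) zs \<one> \<in> carrier G" for zs
    by (induction zs) auto
  show "set xs \<subseteq> carrier G \<Longrightarrow> set ys \<subseteq> carrier G \<Longrightarrow> ?thesis"
    by (induction xs) (auto simp: closed m_assoc)
qed

lemma (in group) generate_word:
  assumes "X \<subseteq> carrier G" "g \<in> generate G X"
  shows "\<exists>xs. set xs \<subseteq> X \<union> m_inv G ` X \<and> foldr (\<otimes>) xs \<one> = g"
  using assms(2)
proof (induction rule: generate.induct)
  case one
  then show ?case by (intro exI[of _ "[]"]) simp
next
  case (incl h)
  then show ?case using assms(1) by (intro exI[of _ "[h]"]) auto
next
  case (inv h)
  then show ?case using assms(1) by (intro exI[of _ "[inv h]"]) auto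
next
  case (eng h1 h2)
  then obtain xs ys where xs: "set xs \<subseteq> X \<union> m_inv G ` X" "foldr (\<otimes>) xs \<one> = h1"
    and ys: "set ys \<subseteq> X \<union> m_inv G ` X" "foldr (\<otimes>) ys \<one> = h2" by blast
  have "X \<union> m_inv G ` X \<subseteq> carrier G" using assms(1) by auto
  then show ?case
    using foldr_mult_append[of xs ys] xs ys by (intro exI[of _ "xs @ ys"]) auto
qed

lemma (in group) word_length_attained:
  assumes "X \<subseteq> carrier G" "g \<in> generate G X"
  obtains xs where "length xs = word_length G X g" "set xs \<subseteq> X \<union> m_inv G ` X"
    "foldr (\<otimes>) xs \<one> = g"
proof -
  have "\<exists>n xs. length xs = n \<and> set xs \<subseteq> X \<union> m_inv G ` X \<and> foldr (\<otimes>) xs \<one> = g"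
    using generate_word[OF assms] by blast
  from LeastI_ex[OF this] show ?thesis using that unfolding word_length_def by blast
qed

lemma word_length_le:
  "set xs \<subseteq> X \<union> m_inv G ` X \<Longrightarrow> foldr (monoid.mult G) xs (monoid.one G) = g \<Longrightarrow> word_length G X g \<le> length xs"
  unfolding word_length_def by (rule Least_le) blast

lemma (in group_length) len_le_word_length:
  assumes "finite Y" "Y \<subseteq> carrier G"
  obtains M where "\<And>g. g \<in> generate G Y \<Longrightarrow> len g \<le> M * word_length G Y g"
proof -
  let ?Z = "Y \<union> m_inv G ` Y"
  have Z: "finite ?Z" "?Z \<subseteq> carrier G" using assms by auto
  obtain M where M: "\<And>z. z \<in> ?Z \<Longrightarrow> len z \<le> M"
    using finite_nat_set_iff_bounded_le[of "len ` ?Z"] Z(1) by auto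
  show ?thesis
  proof (rule that)
    fix g assume "g \<in> generate G Y"
    then obtain xs where "length xs = word_length G Y g" "set xs \<subseteq> ?Z" "foldr (\<otimes>) xs \<one> = g"
      using word_length_attained[OF assms(2)] by blast
    then show "len g \<le> M * word_length G Y g" using len_foldr(1)[OF _ Z(2) M, of xs] by simp
  qed
qed

section \<open>Short exponent vectors\<close>

locale abelian_group_length = comm_group G + group_length G len for G (structure) and len +
  fixes X :: "'a set"
  assumes X_finite: "finite X" and X_carrier: "X \<subseteq> carrier G" and X_generate: "generate G X = carrier G"
    and len_pow: "g \<in> carrier G \<Longrightarrow> g \<noteq> \<one> \<Longrightarrow> n \<le> len (g [^] (n::nat))"
begin

definition power_product :: "('a \<Rightarrow> int) \<Rightarrow> 'a" where
  "power_product m = (\<Otimes>x\<in>X. x [^] m x)"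

definition l1_norm :: "('a \<Rightarrow> int) \<Rightarrow> int" where
  "l1_norm m = (\<Sum>x\<in>X. \<bar>m x\<bar>)"

lemma power_product_closed [simp]: "power_product m \<in> carrier G"
  unfolding power_product_def using X_carrier by (intro finprod_closed) auto

lemma power_product_cong: "(\<And>x. x \<in> X \<Longrightarrow> m x = m' x) \<Longrightarrow> power_product m = power_product m'"
  unfolding power_product_def using X_carrier by (intro finprod_cong) (auto simp: simp_implies_def)

lemma power_product_add: "power_product (\<lambda>x. m x + m' x) = power_product m \<otimes> power_product m'"
proof -
  have "power_product (\<lambda>x. m x + m' x) = (\<Otimes>x\<in>X. x [^] m x \<otimes> x [^] m' x)"
    unfolding power_product_def using X_carrier by (intro finprod_cong) (auto simp: int_pow_mult simp_implies_def)
  also have "\<dots> = power_product m \<otimes> power_product m'"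
    unfolding power_product_def using X_carrier by (intro finprod_multf) auto
  finally show ?thesis .
qed

lemma power_product_0 [simp]: "power_product (\<lambda>_. 0) = \<one>"
  by (simp add: power_product_def)

lemma power_product_scale: "power_product (\<lambda>x. int n * m x) = power_product m [^] n"
proof (induction n)
  case (Suc n)
  have "power_product (\<lambda>x. int (Suc n) * m x) = power_product (\<lambda>x. int n * m x + m x)"
    by (rule power_product_cong) (simp add: algebra_simps)
  then show ?case using Suc by (simp add: power_product_add)
qed simp

lemma power_product_uminus: "power_product (\<lambda>x. - m x) = inv (power_product m)"
proof (rule inv_equality[symmetric])
  show "power_product (\<lambda>x. - m x) \<otimes> power_product m = \<one>" using power_product_add[of "\<lambda>x. - m x" m] by simp
qed simp_all

lemma power_product_surj:
  assumes "g \<in> carrier G"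
  shows "\<exists>m. power_product m = g"
proof -
  have single: "power_product (\<lambda>y. if y = x then 1 else 0) = x" if "x \<in> X" for x
  proof -
    have "power_product (\<lambda>y. if y = x then 1 else 0) = (\<Otimes>y\<in>X. if x = y then y else \<one>)"
      unfolding power_product_def using X_carrier
      by (intro finprod_cong) (auto simp: simp_implies_def)
    then show ?thesis using finprod_singleton[OF that X_finite, of "\<lambda>y. y"] X_carrier by auto
  qed
  have "g \<in> generate G X" using assms X_generate by simp
  then show ?thesis
  proof (induction rule: generate.induct)
    case one
    then show ?case using power_product_0 by blast
  next
    case (incl h)
    then show ?case using single by blast
  next
    case (inv h)
    then show ?case using single power_product_uminus by metis
  next
    case (eng h1 h2)
    then show ?case using power_product_add by metis
  qed
qed

lemma len_power_product:
  assumes "\<And>x. x \<in> X \<Longrightarrow> len x \<le> L"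
  shows "int (len (power_product m)) \<le> int L * l1_norm m"
proof -
  have "int (len (\<Otimes>x\<in>F. x [^] m x)) \<le> int L * (\<Sum>x\<in>F. \<bar>m x\<bar>)" if "finite F" "F \<subseteq> X" for F
    using that
  proof (induction F rule: finite_induct)
    case (insert y F)
    have y: "y \<in> carrier G" and F: "F \<subseteq> carrier G" using insert.prems X_carrier by auto
    have "int (len (\<Otimes>x\<in>insert y F. x [^] m x)) \<le> int (len (y [^] m y)) + int (len (\<Otimes>x\<in>F. x [^] m x))"
      using len_mult[of "y [^] m y" "\<Otimes>x\<in>F. x [^] m x"] insert.hyps y F
      by (subst finprod_insert) (auto intro!: finprod_closed simp flip: of_nat_add)
    also have "int (len (y [^] m y)) \<le> \<bar>m y\<bar> * int (len y)" by (rule len_int_pow[OF y])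
    also have "\<dots> \<le> \<bar>m y\<bar> * int L"
      using assms[of y] insert.prems by (intro mult_left_mono) auto
    finally show ?case using insert by (simp add: algebra_simps)
  qed (simp add: len_one)
  then show ?thesis using X_finite unfolding power_product_def l1_norm_def by blast
qed

lemma power_product_word:
  "\<exists>xs. int (length xs) = l1_norm m \<and> set xs \<subseteq> X \<union> m_inv G ` X \<and> foldr (\<otimes>) xs \<one> = power_product m"
proof -
  have pow: "\<exists>xs. length xs = n \<and> set xs \<subseteq> {x} \<and> foldr (\<otimes>) xs \<one> = x [^] n" if "x \<in> carrier G" for x and n :: nat
  proof (induction n)
    case (Suc n)
    then obtain xs where "length xs = n" "set xs \<subseteq> {x}" "foldr (\<otimes>) xs \<one> = x [^] n" by blast
    then show ?case using that by (intro exI[of _ "x # xs"]) (simp add: m_comm)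
  qed (intro exI[of _ "[]"], simp)
  have int_pow: "\<exists>xs. int (length xs) = \<bar>k\<bar> \<and> set xs \<subseteq> X \<union> m_inv G ` X \<and> foldr (\<otimes>) xs \<one> = x [^] k"
    if "x \<in> X" for x k
  proof -
    have x: "x \<in> carrier G" using that X_carrier by blast
    show ?thesis
    proof (cases "0 \<le> k")
      case True
      then obtain n where k: "k = int n" by (metis nonneg_int_cases)
      from pow[OF x, of n] obtain xs where
        "length xs = n" "set xs \<subseteq> {x}" "foldr (\<otimes>) xs \<one> = x [^] n" by blast
      then show ?thesis using that by (intro exI[of _ xs]) (auto simp: k int_pow_int)
    next
      case False
      then obtain n where k: "k = - int n" by (metis linear nonpos_int_cases)
      from pow[of "inv x" n] x obtain xs where
        "length xs = n" "set xs \<subseteq> {inv x}" "foldr (\<otimes>) xs \<one> = (inv x) [^] n" by auto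
      then show ?thesis using that x by (intro exI[of _ xs]) (auto simp: k int_pow_neg_int nat_pow_inv)
    qed
  qed
  have "\<exists>xs. int (length xs) = (\<Sum>x\<in>F. \<bar>m x\<bar>) \<and> set xs \<subseteq> X \<union> m_inv G ` X \<and>
      foldr (\<otimes>) xs \<one> = (\<Otimes>x\<in>F. x [^] m x)" if "finite F" "F \<subseteq> X" for F
    using that
  proof (induction F rule: finite_induct)
    case empty
    then show ?case by (intro exI[of _ "[]"]) simp
  next
    case (insert y F)
    obtain xs where xs: "int (length xs) = (\<Sum>x\<in>F. \<bar>m x\<bar>)" "set xs \<subseteq> X \<union> m_inv G ` X"
      "foldr (\<otimes>) xs \<one> = (\<Otimes>x\<in>F. x [^] m x)" using insert by auto
    obtain ys where ys: "int (length ys) = \<bar>m y\<bar>" "set ys \<subseteq> X \<union> m_inv G ` X"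
      "foldr (\<otimes>) ys \<one> = y [^] m y" using int_pow[of y "m y"] insert.prems by auto
    have XX: "X \<union> m_inv G ` X \<subseteq> carrier G" using X_carrier by auto
    have "(\<Otimes>x\<in>insert y F. x [^] m x) = y [^] m y \<otimes> (\<Otimes>x\<in>F. x [^] m x)"
      using insert.hyps insert.prems X_carrier by (intro finprod_insert) auto
    then show ?case
      using foldr_mult_append[of ys xs] xs ys XX insert.hyps by (intro exI[of _ "ys @ xs"]) auto
  qed
  then show ?thesis using X_finite unfolding power_product_def l1_norm_def by blast
qed

lemma l1_norm_nonneg: "0 \<le> l1_norm m"
  by (simp add: l1_norm_def sum_nonneg)

text \<open>
The generators may satisfy relations, so exponent vectors are not unique. A least one takes the place
of coordinates: a relation whose exponents are nearly proportional to \<open>m\<close> would contradict its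
minimality.
\<close>
theorem word_length_le_len:
  obtains C where "0 < C" "\<And>g. g \<in> carrier G \<Longrightarrow> word_length G X g \<le> C * len g"
proof -
  obtain L where L: "\<And>x. x \<in> X \<Longrightarrow> len x \<le> L"
    using finite_nat_set_iff_bounded_le[of "len ` X"] X_finite by auto
  let ?k = "card X"
  \<comment> \<open>The error has l1 norm at most \<open>?k * n / N\<close>. This is less than \<open>n\<close>, and \<open>L\<close> times it is at most \<open>n / 2\<close>.\<close>
  define N where "N = 2 * ?k * L + ?k + 1"
  have N: "0 < N" by (simp add: N_def)
  show ?thesis
  proof (rule that[of "2 * N ^ ?k"])
    show "0 < 2 * N ^ ?k" using N by simp
  next
    fix g assume g: "g \<in> carrier G"
    obtain m where m: "power_product m = g" and least: "\<And>m'. power_product m' = g \<Longrightarrow> nat (l1_norm m) \<le> nat (l1_norm m')"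
      using ex_has_least_nat[of "\<lambda>m. power_product m = g" _ "\<lambda>m. nat (l1_norm m)"] power_product_surj[OF g] by blast
    define n where "n = nat (l1_norm m)"
    have n: "int n = l1_norm m" using l1_norm_nonneg by (simp add: n_def)
    have "n \<le> 2 * N ^ ?k * len g"
    proof (cases "n = 0")
      case False
      then have "0 < n" by simp
      have "g \<noteq> \<one>" using least[of "\<lambda>_. 0"] False by (auto simp: n_def l1_norm_def)
      then have "1 \<le> len g" using len_pow[OF g, of 1] g by simp
      obtain q p where q: "0 < q" "q \<le> N ^ ?k"
        and p: "\<And>x. x \<in> X \<Longrightarrow> int N * \<bar>int n * p x - int q * m x\<bar> \<le> int n"
        using simultaneous_approximation_int[OF X_finite N \<open>0 < n\<close>, of m] by blast
      define e where "e = (\<lambda>x. int n * p x - int q * m x)"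
      have e: "int N * l1_norm e \<le> int ?k * int n"
        using sum_mono[of X "\<lambda>x. int N * \<bar>e x\<bar>" "\<lambda>_. int n"] p
        by (simp add: l1_norm_def e_def sum_distrib_left)
      show ?thesis
      proof (cases "power_product p = \<one>")
        case False
        have "power_product p [^] n = power_product (\<lambda>x. int q * m x + e x)"
          unfolding power_product_scale[symmetric] by (rule power_product_cong) (simp add: e_def)
        also have "\<dots> = g [^] q \<otimes> power_product e" by (simp add: power_product_add power_product_scale m)
        finally have "n \<le> len (g [^] q \<otimes> power_product e)" using len_pow[OF power_product_closed False, of n] by simp
        also have "\<dots> \<le> len (g [^] q) + len (power_product e)" using g by (intro len_mult) auto
        also have "len (g [^] q) \<le> q * len g" by (rule len_nat_pow[OF g])
        finally have "int n \<le> int q * int (len g) + int (len (power_product e))"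
          by (simp flip: of_nat_mult of_nat_add)
        then have "int n \<le> int q * int (len g) + int L * l1_norm e"
          using len_power_product[OF L, of e] by linarith
        then have "int N * int n \<le> int N * (int q * int (len g) + int L * l1_norm e)"
          by (rule mult_left_mono) simp
        also have "\<dots> = int N * (int q * int (len g)) + int L * (int N * l1_norm e)"
          by (simp add: algebra_simps)
        also have "int L * (int N * l1_norm e) \<le> int L * (int ?k * int n)"
          by (rule mult_left_mono[OF e]) simp
        finally have "2 * (int N * int n) \<le> 2 * (int N * (int q * int (len g))) + (2 * int ?k * int L) * int n"
          by (simp add: algebra_simps)
        also have "(2 * int ?k * int L) * int n \<le> int N * int n"
          by (rule mult_right_mono) (simp_all add: N_def)
        finally have "int N * int n \<le> int N * (2 * (int q * int (len g)))" by simp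
        then have "int n \<le> 2 * (int q * int (len g))" using N by (simp add: mult_le_cancel_left)
        then have "n \<le> 2 * (q * len g)" by (simp flip: of_nat_mult of_nat_add)
        also have "\<dots> \<le> 2 * (N ^ ?k * len g)" using q(2) by (intro mult_le_mono) auto
        finally show ?thesis by (simp add: mult.assoc)
      next
        case True
        have "power_product (\<lambda>x. m x - p x) = g"
          using power_product_add[of m "\<lambda>x. - p x"] g by (simp add: power_product_uminus True m)
        from least[OF this] have short: "int n \<le> l1_norm (\<lambda>x. m x - p x)"
          using l1_norm_nonneg[of "\<lambda>x. m x - p x"] unfolding n_def by linarith
        have "n < q"
        proof (rule ccontr)
          assume "\<not> n < q"
          \<comment> \<open>\<open>m - p\<close> is the vector \<open>(1 - q / n) m\<close> up to the error \<open>e / n\<close>.\<close>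
          have "int n * \<bar>m x - p x\<bar> \<le> (int n - int q) * \<bar>m x\<bar> + \<bar>e x\<bar>" for x
          proof -
            have "int n * \<bar>m x - p x\<bar> = \<bar>int n * (m x - p x)\<bar>" by (simp add: abs_mult)
            also have "int n * (m x - p x) = (int n - int q) * m x - e x"
              by (simp add: e_def algebra_simps)
            also have "\<bar>\<dots>\<bar> \<le> \<bar>(int n - int q) * m x\<bar> + \<bar>e x\<bar>" by (rule abs_triangle_ineq4)
            also have "\<bar>(int n - int q) * m x\<bar> = (int n - int q) * \<bar>m x\<bar>"
              using \<open>\<not> n < q\<close> by (simp add: abs_mult)
            finally show ?thesis .
          qed
          then have "int n * l1_norm (\<lambda>x. m x - p x) \<le> (int n - int q) * l1_norm m + l1_norm e"
            unfolding l1_norm_def sum_distrib_left sum.distrib[symmetric] by (rule sum_mono)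
          moreover have "int n * int n \<le> int n * l1_norm (\<lambda>x. m x - p x)"
            by (rule mult_left_mono[OF short]) simp
          ultimately have "int q * int n \<le> l1_norm e" using n by (simp add: algebra_simps)
          moreover have "1 * int n \<le> int q * int n" using q(1) by (intro mult_right_mono) auto
          ultimately have "int N * int n \<le> int N * l1_norm e" by (intro mult_left_mono) auto
          with e have "int N * int n \<le> int ?k * int n" by linarith
          then have "int N \<le> int ?k" using \<open>0 < n\<close> by simp
          then have "N \<le> ?k" by simp
          then show False unfolding N_def by linarith
        qed
        \<comment> \<open>So \<open>n\<close> is bounded, while \<open>len g\<close> is at least 1.\<close>
        also have "q \<le> N ^ ?k * 1" using q by simp
        also have "\<dots> \<le> 2 * N ^ ?k * len g" using \<open>1 \<le> len g\<close> by (intro mult_le_mono) auto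
        finally show ?thesis by simp
      qed
    qed simp
    moreover obtain xs where "int (length xs) = l1_norm m" "set xs \<subseteq> X \<union> m_inv G ` X"
        "foldr (\<otimes>) xs \<one> = power_product m"
      using power_product_word by blast
    then have "word_length G X g \<le> n" using word_length_le[of xs X G g] n m by simp
    ultimately show "word_length G X g \<le> 2 * N ^ ?k * len g" by simp
  qed
qed

end

text \<open>
On \<open>A\<close> the word length for \<open>X\<close> is bounded in terms of \<open>len\<close>, and on \<open>B\<close> the function \<open>len\<close> is bounded
in terms of the word length for \<open>Y\<close>.
\<close>
theorem (in group_length) undistorted:
  assumes B: "subgroup B G" and A: "subgroup A (G\<lparr>carrier := B\<rparr>)"
    and comm: "comm_group (G\<lparr>carrier := A\<rparr>)"
    and growth: "\<And>g n. g \<in> A \<Longrightarrow> g \<noteq> \<one> \<Longrightarrow> n \<le> len (g [^] (n::nat))"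
  shows "quasi_isometrically_embedded G A B"
  unfolding quasi_isometrically_embedded_def
proof (intro allI impI)
  fix X Y assume X: "finite_generating_set G A X" and Y: "finite_generating_set G B Y"
  let ?H = "G\<lparr>carrier := A\<rparr>"
  have AB: "A \<subseteq> B" using subgroup.subset[OF A] by simp
  have AG: "subgroup A G" using incl_subgroup[OF B A] .
  interpret H: comm_group ?H by (rule comm)
  have inv: "m_inv ?H x = inv x" if "x \<in> A" for x using m_inv_consistent[OF AG that] .
  have pow: "x [^]\<^bsub>?H\<^esub> n = x [^] n" for x and n :: nat by (simp add: nat_pow_def)
  have XA: "finite X" "X \<subseteq> A" "generate G X = A"
    using X generate.incl[of _ X G] unfolding finite_generating_set_def by auto
  interpret K: abelian_group_length ?H len X
  proof
    show "len \<one>\<^bsub>?H\<^esub> = 0" by (simp add: len_one)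
    show "len (x \<otimes>\<^bsub>?H\<^esub> y) \<le> len x + len y" if "x \<in> carrier ?H" "y \<in> carrier ?H" for x y
      using that len_mult subgroup.subset[OF AG] by auto
    show "len (inv\<^bsub>?H\<^esub> x) \<le> len x" if "x \<in> carrier ?H" for x
      using that len_inv subgroup.subset[OF AG] by (auto simp: inv)
    show "generate ?H X = carrier ?H" using generate_consistent[OF XA(2) AG] XA(3) by simp
    show "n \<le> len (g [^]\<^bsub>?H\<^esub> n)" if "g \<in> carrier ?H" "g \<noteq> \<one>\<^bsub>?H\<^esub>" for g and n :: nat
      using that growth pow by simp
  qed (use XA in auto)
  obtain C where C: "0 < C" "\<And>g. g \<in> A \<Longrightarrow> word_length ?H X g \<le> C * len g"
    using K.word_length_le_len by auto
  have "word_length G X g = word_length ?H X g" for g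
  proof -
    have "m_inv ?H ` X = m_inv G ` X" using inv XA(2) by (intro image_cong) auto
    then show ?thesis by (simp add: word_length_def)
  qed
  note wl = this
  obtain M where M: "\<And>g. g \<in> generate G Y \<Longrightarrow> len g \<le> M * word_length G Y g"
    using len_le_word_length[of Y] Y unfolding finite_generating_set_def by blast
  have "word_length G X g \<le> C * (M + 1) * word_length G Y g" if "g \<in> A" for g
  proof -
    have "word_length G X g \<le> C * len g" using C(2) that wl by simp
    also have "len g \<le> (M + 1) * word_length G Y g"
      using M[of g] that AB Y unfolding finite_generating_set_def by auto
    finally show ?thesis by (simp add: algebra_simps)
  qed
  then show "\<exists>C>0. \<forall>g\<in>A. word_length G X g \<le> C * word_length G Y g"
    using C(1) by (intro exI[of _ "C * (M + 1)"]) auto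
qed

section \<open>Abelian subgroups of diagram groups\<close>

theorem theorem33:
  fixes S :: "'a set" and R :: "('a list \<times> 'a list) set" and w :: "'a list"
    and G :: "('g, 'm) monoid_scheme" and A B :: "'g set"
  assumes "semigroup_presentation S R"
    and "w \<in> nonempty_words S"
    and "group G"
    and "G \<cong> diagram_group S R w"
    and "subgroup B G"
    and "\<exists>Y. finite_generating_set G B Y"
    and "subgroup A (G\<lparr>carrier := B\<rparr>)"
    and "comm_group (G\<lparr>carrier := A\<rparr>)"
    and "\<exists>X. finite_generating_set G A X"
  shows "quasi_isometrically_embedded G A B"
proof -
  interpret pointed_presentation S R w
    by unfold_locales (use assms in auto)
  interpret group G by (rule assms(3))
  obtain h where h: "h \<in> iso G D" using assms(4) by (auto simp: is_iso_def)
  interpret group_hom G D h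
    by (rule group_hom.intro[OF assms(3) group_D]) (use h in \<open>simp add: group_hom_axioms_def iso_def\<close>)
  have inj: "inj_on h (carrier G)" using h by (simp add: iso_def bij_betw_def)
  interpret group_length G "\<lambda>g. loop_length (h g)"
    by unfold_locales (simp_all add: loop_length_one loop_length_mult loop_length_inv)
  show ?thesis
  proof (rule undistorted[OF assms(5,7,8)])
    fix g and n :: nat assume g: "g \<in> A" "g \<noteq> \<one>\<^bsub>G\<^esub>"
    have "g \<in> carrier G"
      using subgroup.mem_carrier[OF assms(7) g(1)] subgroup.mem_carrier[OF assms(5)] by simp
    moreover from this have "h g \<noteq> \<one>\<^bsub>D\<^esub>"
      using g(2) inj inj_onD[OF inj, of g "\<one>\<^bsub>G\<^esub>"] by auto
    ultimately show "n \<le> loop_length (h (g [^]\<^bsub>G\<^esub> n))"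
      using loop_length_power[of "h g" n] by (simp add: hom_nat_pow)
  qed
qed

end
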